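(* Let $\rho\in L^1(\mathbb{R})$ with values in $[0,1]$ and $\rho\not\equiv0$. Then $$\forall k\in\mathbb{N},\qquad \mu_k(\rho)\le\frac{\pi^2k^2}{\big(\int_{\mathbb{R}}\rho\,dx\big)^2}.$$
   Context: For a measurable $\rho:\mathbb{R}\to[0,1]$ with $0<\int_{\mathbb{R}}\rho\,dx<+\infty$ and an integer $k\ge 0$, $$\mu_k(\rho):=\inf_{S\in\mathcal{S}_{k+1}}\ \max_{u\in S\setminus\{0\}}\frac{\int_{\mathbb{R}}\rho\,(u')^2dx}{\int_{\mathbb{R}}\rho u^2dx},$$ where $\mathcal{S}_{k+1}$ is the family of all linear subspaces of dimension $k+1$ of $\{u\cdot 1_{\{\rho>0\}}:u\in C_c^\infty(\mathbb{R})\}$ (functions identified when equal almost everywhere; $u'$ is the derivative of the smooth function $u$, which on $\{\rho>0\}$ depends only on $u\cdot 1_{\{\rho>0\}}$ up to null sets). *)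

theory Defs
  imports "HOL-Analysis.Analysis"
begin

definition ae_eq :: "(real \<Rightarrow> real) \<Rightarrow> (real \<Rightarrow> real) \<Rightarrow> bool" where
  "ae_eq f g \<longleftrightarrow> (AE x in lebesgue. f x = g x)"

lemma equivp_ae_eq: "equivp ae_eq"
proof (rule equivpI)
  show "reflp ae_eq" by (auto simp: ae_eq_def intro!: reflpI)
  show "symp ae_eq" by (auto simp: ae_eq_def eq_commute intro!: sympI)
  show "transp ae_eq"
  proof (rule transpI)
    fix f g h assume "ae_eq f g" "ae_eq g h"
    then show "ae_eq f h" unfolding ae_eq_def by eventually_elim simp
  qed
qed

quotient_type ae_fun = "real \<Rightarrow> real" / ae_eq
  morphisms rep_ae_fun ae_class
  by (rule equivp_ae_eq)

instantiation ae_fun :: real_vector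
begin

lift_definition zero_ae_fun :: ae_fun is "\<lambda>x. 0" .

lift_definition plus_ae_fun :: "ae_fun \<Rightarrow> ae_fun \<Rightarrow> ae_fun" is "\<lambda>f g x. f x + g x"
  unfolding ae_eq_def by (erule (1) eventually_elim2) simp

lift_definition minus_ae_fun :: "ae_fun \<Rightarrow> ae_fun \<Rightarrow> ae_fun" is "\<lambda>f g x. f x - g x"
  unfolding ae_eq_def by (erule (1) eventually_elim2) simp

lift_definition uminus_ae_fun :: "ae_fun \<Rightarrow> ae_fun" is "\<lambda>f x. - f x"
  unfolding ae_eq_def by (erule eventually_mono) simp

lift_definition scaleR_ae_fun :: "real \<Rightarrow> ae_fun \<Rightarrow> ae_fun" is "\<lambda>c f x. c * f x"
  unfolding ae_eq_def by (erule eventually_mono) simp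

instance
  by standard (transfer; simp add: ae_eq_def algebra_simps)+

end

text \<open>The real-valued functions in \<open>C\<^sub>c\<^sup>\<infinity>(\<real>)\<close>.\<close>

definition test_functions :: "(real \<Rightarrow> real) set" where
  "test_functions =
     {u. (\<forall>n x. (deriv ^^ n) u differentiable at x) \<and> compact (closure {x. u x \<noteq> 0})}"

definition restricted_class :: "(real \<Rightarrow> real) \<Rightarrow> (real \<Rightarrow> real) \<Rightarrow> ae_fun" where
  "restricted_class \<rho> u = ae_class (\<lambda>x. u x * indicator {y. \<rho> y > 0} x)"

text \<open>
  \<^const>\<open>dim\<close> is \<open>0\<close> on infinite-dimensional subspaces, so the dimension condition
  below does force finite dimension.
\<close>

definition test_subspaces :: "(real \<Rightarrow> real) \<Rightarrow> nat \<Rightarrow> ae_fun set set" where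
  "test_subspaces \<rho> k =
     {S. subspace S \<and> S \<subseteq> restricted_class \<rho> ` test_functions \<and> dim S = k + 1}"

definition rayleigh :: "(real \<Rightarrow> real) \<Rightarrow> (real \<Rightarrow> real) \<Rightarrow> real" where
  "rayleigh \<rho> u =
     (\<integral>x. \<rho> x * (deriv u x)\<^sup>2 \<partial>lebesgue) / (\<integral>x. \<rho> x * (u x)\<^sup>2 \<partial>lebesgue)"

text \<open>
  The inner supremum ranges over all smooth representatives of the nonzero elements of
  \<open>S\<close>; \<open>rayleigh \<rho> u\<close> depends only on \<open>restricted_class \<rho> u\<close>, and as \<open>S\<close> is
  finite-dimensional the supremum is a finite maximum. Working in the extended reals, no
  default value of an unbounded supremum or an empty infimum can enter.
\<close>

definition mu :: "(real \<Rightarrow> real) \<Rightarrow> nat \<Rightarrow> ereal" where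
  "mu \<rho> k =
     (INF S \<in> test_subspaces \<rho> k.
        SUP u \<in> {u \<in> test_functions. restricted_class \<rho> u \<in> S - {0}}. ereal (rayleigh \<rho> u))"

end

theory Submission
  imports Defs
begin

text \<open>
  Let \<open>F x\<close> be the integral of \<open>\<rho>\<close> over \<open>{..x}\<close> and \<open>M\<close> the total mass. As \<open>\<rho> \<le> 1\<close>, \<open>F\<close> is
  1-Lipschitz, so for \<open>p t = (\<Sum>j\<le>k. a j * cos (j * pi * t / M))\<close> the function \<open>p (F x)\<close> has
  numerator at most the integral of \<open>\<rho> * (p' (F x))\<^sup>2\<close>. The substitution \<open>t = F x\<close> turns this and the
  denominator into integrals over \<open>{0..M}\<close>, where orthogonality bounds the quotient by
  \<open>(k * pi / M)\<^sup>2\<close>.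

  To obtain test functions, \<open>F\<close> is replaced on a large interval by a uniformly close polynomial \<open>G\<close>
  with \<open>\<bar>deriv G\<bar> \<le> 1 + e\<close>, and \<open>p (G x)\<close> is multiplied by a slowly varying bump. The errors are
  of order \<open>e\<close> uniformly on the coefficient sphere. Smoothness comes from working in
  a class of functions that is closed under differentiation.
\<close>

section \<open>Smooth functions and approximation\<close>

text \<open>\<open>flat_exp 0\<close> is the classical smooth function vanishing on the negative
  half-line. The powers of \<open>x\<close> in the denominator turn it into a family in which every
  derivative is a linear combination of members.\<close>

definition flat_exp :: "nat \<Rightarrow> real \<Rightarrow> real" where
  "flat_exp n x = (if x > 0 then exp (- 1 / x) / x ^ n else 0)"

text \<open>From the right, the substitution y = 1 / x reduces the limit to the exponential
  outgrowing every power; from the left the function is 0.\<close>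

lemma isCont_flat_exp_0: "isCont (flat_exp n) 0"
proof -
  have "((\<lambda>x. inverse x ^ n / exp (inverse x :: real)) \<longlongrightarrow> 0) (at_right 0)"
    by (rule filterlim_compose[OF tendsto_power_div_exp_0 filterlim_inverse_at_top_right])
  moreover have "\<forall>\<^sub>F x in at_right 0. inverse x ^ n / exp (inverse x :: real) = flat_exp n x"
    by (rule eventually_at_rightI[of 0 1])
      (auto simp: flat_exp_def exp_minus field_simps)
  ultimately have "(flat_exp n \<longlongrightarrow> 0) (at_right 0)"
    by (rule Lim_transform_eventually)
  moreover have "(flat_exp n \<longlongrightarrow> 0) (at_left 0)"
  proof (rule Lim_transform_eventually[OF tendsto_const[of 0]])
    show "\<forall>\<^sub>F x in at_left 0. 0 = flat_exp n x"
      by (rule eventually_at_leftI[of "-1"]) (auto simp: flat_exp_def)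
  qed
  ultimately show ?thesis
    by (simp add: isCont_def filterlim_split_at flat_exp_def)
qed

lemma flat_exp_has_field_derivative:
  "(flat_exp n has_field_derivative flat_exp (n + 2) x - real n * flat_exp (n + 1) x) (at x)"
proof -
  consider "x > 0" | "x < 0" | "x = 0" by linarith
  then show ?thesis
  proof cases
    case 1
    have "((\<lambda>x. exp (- 1 / x) / x ^ n) has_field_derivative
        flat_exp (n + 2) x - real n * flat_exp (n + 1) x) (at x)"
    proof -
      \<comment> \<open>Truncated subtraction: for \<open>n = 0\<close> both sides vanish because of
        the factor \<open>real n\<close>.\<close>
      have "real n * x ^ (n - 1) = real n * x ^ n / x"
        using 1 by (cases n) auto
      then have "((\<lambda>x. exp (- 1 / x) / x ^ n) has_field_derivative
          (exp (- 1 / x) * (1 / x ^ 2) * x ^ n - exp (- 1 / x) * (real n * x ^ n / x))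
            / (x ^ n * x ^ n)) (at x)"
        using 1 by (auto intro!: derivative_eq_intros simp: power2_eq_square)
      also have "(exp (- 1 / x) * (1 / x ^ 2) * x ^ n - exp (- 1 / x) * (real n * x ^ n / x))
            / (x ^ n * x ^ n) = flat_exp (n + 2) x - real n * flat_exp (n + 1) x"
        using 1 by (simp add: flat_exp_def field_simps power2_eq_square)
      finally show ?thesis .
    qed
    then show ?thesis
    proof (rule has_field_derivative_transform_within_open[of _ _ _ "{0<..}"])
    qed (use 1 in \<open>auto simp: flat_exp_def\<close>)
  next
    case 2
    have "((\<lambda>x. 0) has_field_derivative 
        flat_exp (n + 2) x - real n * flat_exp (n + 1) x) (at x)"
      using 2 by (simp add: flat_exp_def)
    then show ?thesis
    proof (rule has_field_derivative_transform_within_open[of _ _ _ "{..<0}"])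
    qed (use 2 in \<open>auto simp: flat_exp_def\<close>)
  next
    case 3
    have "(flat_exp (Suc n) \<longlongrightarrow> 0) (at 0)"
      using isCont_flat_exp_0[of "Suc n"] by (simp add: isCont_def flat_exp_def)
    \<comment> \<open>The difference quotient at 0 is the next member of the family, so its
      continuity gives the derivative. At \<open>h = 0\<close> both sides are 0 since division by
      zero yields 0.\<close>
    moreover have "flat_exp (Suc n) = (\<lambda>h. (flat_exp n (0 + h) - flat_exp n 0) / h)"
      by (auto simp: flat_exp_def)
    ultimately show ?thesis using 3
      by (simp add: DERIV_def flat_exp_def)
  qed
qed

section \<open>A class of smooth functions closed under differentiation\<close>

text \<open>Membership replaces smoothness proofs: \<open>deriv\<close> maps the class into itself,
  so every iterated derivative is again differentiable. The generators are what polynomials, cosine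
  sums and bumps require.\<close>

inductive_set elementary :: "(real \<Rightarrow> real) set" where
  const: "(\<lambda>x. c) \<in> elementary"
| ident: "(\<lambda>x. x) \<in> elementary"
| add: "f \<in> elementary \<Longrightarrow> g \<in> elementary \<Longrightarrow> (\<lambda>x. f x + g x) \<in> elementary"
| mult: "f \<in> elementary \<Longrightarrow> g \<in> elementary \<Longrightarrow> (\<lambda>x. f x * g x) \<in> elementary"
| sin: "f \<in> elementary \<Longrightarrow> (\<lambda>x. sin (f x)) \<in> elementary"
| cos: "f \<in> elementary \<Longrightarrow> (\<lambda>x. cos (f x)) \<in> elementary"
| flat_exp: "f \<in> elementary \<Longrightarrow> (\<lambda>x. flat_exp n (f x)) \<in> elementary"

lemma elementary_minus:
  assumes "f \<in> elementary" shows "(\<lambda>x. - f x) \<in> elementary"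
  using elementary.mult[OF elementary.const[of "-1"] assms] by simp

lemma elementary_diff:
  assumes "f \<in> elementary" "g \<in> elementary" shows "(\<lambda>x. f x - g x) \<in> elementary"
  using elementary.add[OF assms(1) elementary_minus[OF assms(2)]] by simp

lemma elementary_sum:
  assumes "\<And>i. i \<in> A \<Longrightarrow> f i \<in> elementary" shows "(\<lambda>x. \<Sum>i\<in>A. f i x) \<in> elementary"
  using assms
  by (induction A rule: infinite_finite_induct) (auto intro: elementary.const elementary.add)

lemma elementary_power: "f \<in> elementary \<Longrightarrow> (\<lambda>x. f x ^ n) \<in> elementary"
  by (induction n) (auto intro: elementary.const elementary.mult)

lemmas elementary_intros = elementary.intros elementary_minus elementary_diff
  elementary_sum elementary_power

lemma elementary_has_derivative:
  assumes "f \<in> elementary"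
  shows "\<exists>g \<in> elementary. \<forall>x. (f has_field_derivative g x) (at x)"
  using assms
proof induction
  case (const c)
  show ?case by (rule bexI[of _ "\<lambda>x. 0"]) (auto intro: elementary_intros)
next
  case ident
  show ?case by (rule bexI[of _ "\<lambda>x. 1"]) (auto intro: elementary_intros)
next
  case (add f g)
  then obtain f' g' where *: "f' \<in> elementary" "g' \<in> elementary"
    "\<And>x. (f has_field_derivative f' x) (at x)" "\<And>x. (g has_field_derivative g' x) (at x)"
    by blast
  then show ?case
    by (intro bexI[of _ "\<lambda>x. f' x + g' x"] allI DERIV_add elementary_intros)
next
  case (mult f g)
  then obtain f' g' where *: "f' \<in> elementary" "g' \<in> elementary"
    "\<And>x. (f has_field_derivative f' x) (at x)" "\<And>x. (g has_field_derivative g' x) (at x)"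
    by blast
  show ?case
    by (intro bexI[of _ "\<lambda>x. f' x * g x + g' x * f x"] allI DERIV_mult elementary_intros * mult.hyps)
next
  case (sin f)
  then obtain f' where *: "f' \<in> elementary" "\<And>x. (f has_field_derivative f' x) (at x)"
    by blast
  show ?case
    by (intro bexI[of _ "\<lambda>x. cos (f x) * f' x"] allI DERIV_chain2[OF DERIV_sin *(2)]
        elementary_intros * sin.hyps)
next
  case (cos f)
  then obtain f' where *: "f' \<in> elementary" "\<And>x. (f has_field_derivative f' x) (at x)"
    by blast
  show ?case
  proof (intro bexI[of _ "\<lambda>x. - sin (f x) * f' x"] allI)
    show "((\<lambda>x. cos (f x)) has_field_derivative - sin (f x) * f' x) (at x)" for x
      by (rule DERIV_chain2[OF DERIV_cos *(2)])
    show "(\<lambda>x. - sin (f x) * f' x) \<in> elementary"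
      by (intro elementary_intros * cos.hyps)
  qed
next
  case (flat_exp f n)
  then obtain f' where *: "f' \<in> elementary" "\<And>x. (f has_field_derivative f' x) (at x)"
    by blast
  show ?case
  proof (intro bexI[of _ "\<lambda>x. (flat_exp (n + 2) (f x) - real n * flat_exp (n + 1) (f x)) * f' x"] allI)
    show "((\<lambda>x. flat_exp n (f x)) has_field_derivative
        (flat_exp (n + 2) (f x) - real n * flat_exp (n + 1) (f x)) * f' x) (at x)" for x
      by (rule DERIV_chain2[OF flat_exp_has_field_derivative *(2)])
    show "(\<lambda>x. (flat_exp (n + 2) (f x) - real n * flat_exp (n + 1) (f x)) * f' x) \<in> elementary"
      by (intro elementary_intros * flat_exp.hyps)
  qed
qed

lemma elementary_deriv:
  assumes "f \<in> elementary"
  shows "deriv f \<in> elementary"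
proof -
  obtain g where g: "g \<in> elementary" "\<forall>x. (f has_field_derivative g x) (at x)"
    using elementary_has_derivative[OF assms] by blast
  then have "deriv f = g"
    by (auto intro!: ext DERIV_imp_deriv)
  with g show ?thesis by simp
qed

lemma elementary_funpow_deriv: "f \<in> elementary \<Longrightarrow> (deriv ^^ n) f \<in> elementary"
  by (induction n) (auto intro: elementary_deriv)

lemma elementary_differentiable: "f \<in> elementary \<Longrightarrow> f differentiable at x"
  using elementary_has_derivative[of f] real_differentiable_def by blast

lemma elementary_field_differentiable: "f \<in> elementary \<Longrightarrow> f field_differentiable at x"
  using elementary_has_derivative[of f] field_differentiable_def by blast

lemma elementary_DERIV: "f \<in> elementary \<Longrightarrow> (f has_field_derivative deriv f x) (at x)"
  by (simp add: DERIV_deriv_iff_field_differentiable elementary_field_differentiable)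

lemma elementary_test_function:
  assumes "f \<in> elementary" "\<And>x. r \<le> \<bar>x\<bar> \<Longrightarrow> f x = 0"
  shows "f \<in> test_functions"
proof -
  have "{x. f x \<noteq> 0} \<subseteq> cball 0 r"
    using assms(2) by (force simp: dist_real_def)
  then have "bounded {x. f x \<noteq> 0}"
    using bounded_cball bounded_subset by blast
  then show ?thesis using assms
    by (auto simp: test_functions_def elementary_differentiable elementary_funpow_deriv)
qed

section \<open>Uniform approximation of a Lipschitz function together with its slope\<close>

text \<open>Approximating a derivative by a polynomial and integrating controls both value and
  slope, which approximating the function alone would not.\<close>

lemma real_polynomial_antiderivative:
  assumes "real_polynomial_function p"
  obtains P where "P \<in> elementary" "\<And>x. (P has_real_derivative p x) (at x)"
proof -
  obtain a n where p: "p = (\<lambda>x. \<Sum>i\<le>n. a i * x ^ i)"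
    using assms real_polynomial_function_iff_sum by blast
  define P where "P = (\<lambda>x. \<Sum>i\<le>n. (a i / real (Suc i)) * x ^ Suc i)"
  have "P \<in> elementary"
    unfolding P_def by (intro elementary_intros)
  moreover have "(P has_real_derivative p x) (at x)" for x
  proof -
    have "((\<lambda>x. (a i / real (Suc i)) * x ^ Suc i) has_real_derivative a i * x ^ i) (at x)" for i
      using DERIV_cmult[OF DERIV_pow[of "Suc i"], of "a i / real (Suc i)" x]
      by (simp del: of_nat_Suc power_Suc)
    then show ?thesis unfolding P_def p by (intro DERIV_sum)
  qed
  ultimately show ?thesis using that by blast
qed

lemma lipschitz_continuous_on:
  fixes f :: "real \<Rightarrow> real"
  assumes "\<And>x y. \<bar>f x - f y\<bar> \<le> L * \<bar>x - y\<bar>"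
  shows "continuous_on A f"
proof (rule lipschitz_on_continuous_on[of L], rule lipschitz_onI)
  show "0 \<le> L" using assms[of 0 1] by simp
qed (use assms in \<open>simp add: dist_real_def\<close>)

text \<open>\<open>F\<close> may fail to be differentiable, so it is first averaged over intervals
  of length \<open>h\<close>. The average is C^1, and its derivative is a difference quotient of
  \<open>F\<close>, hence at most 1 in absolute value. A polynomial close to this derivative is then
  integrated to give \<open>G\<close>.\<close>

lemma lipschitz_approx_elementary:
  fixes F :: "real \<Rightarrow> real"
  assumes lip: "\<And>x y. \<bar>F x - F y\<bar> \<le> \<bar>x - y\<bar>" and "0 < e"
  obtains G where "G \<in> elementary" "\<And>x. \<bar>x\<bar> \<le> R \<Longrightarrow> \<bar>G x - F x\<bar> \<le> e"
    "\<And>x. \<bar>x\<bar> \<le> R \<Longrightarrow> \<bar>deriv G x\<bar> \<le> 1 + e"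
proof -
  define r where "r = \<bar>R\<bar> + 1"
  have r: "r \<ge> 1" "R < r" by (auto simp: r_def)
  define h where "h = min 1 (e / 2)"
  have h: "h > 0" "h \<le> 1" "h \<le> e / 2" using \<open>0 < e\<close> by (auto simp: h_def)
  have contF: "continuous_on A F" for A
    by (rule lipschitz_continuous_on[of _ 1]) (simp add: lip)
  \<comment> \<open>The margin 2 keeps \<open>x\<close> and \<open>x + h\<close> inside the interval
    whenever \<open>\<bar>x\<bar> \<le> r\<close>, as \<open>h \<le> 1\<close>.\<close>
  define \<Phi> where "\<Phi> x = integral {- (r + 2)..x} F" for x
  have d\<Phi>: "(\<Phi> has_real_derivative F x) (at x)" if "\<bar>x\<bar> < r + 2" for x
  proof -
    have "(\<Phi> has_real_derivative F x) (at x within {- (r + 2)..r + 2})"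
      unfolding \<Phi>_def
      by (rule integral_has_real_derivative) (use that contF in auto)
    moreover have "x \<in> interior {- (r + 2)..r + 2}"
      using that by auto
    ultimately show ?thesis using at_within_interior by metis
  qed
  define f where "f x = (\<Phi> (x + h) - \<Phi> x) / h" for x
  define f' where "f' x = (F (x + h) - F x) / h" for x
  have df: "(f has_real_derivative f' x) (at x)" if "\<bar>x\<bar> \<le> r" for x
  proof -
    have "((\<lambda>x. \<Phi> (x + h)) has_real_derivative F (x + h)) (at x)"
      using d\<Phi>[of "x + h"] that h DERIV_shift[of \<Phi> "F (x + h)" x h] by (auto simp: add.commute)
    then show ?thesis
      unfolding f_def f'_def
      using that by (intro DERIV_cdivide DERIV_diff d\<Phi>) auto
  qed
  have f_close: "\<bar>f x - F x\<bar> \<le> e / 2" if "\<bar>x\<bar> \<le> r" for x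
  proof -
    \<comment> \<open>By the mean value theorem the average \<open>f x\<close> is a value of
      \<open>F\<close> at a point within distance \<open>h \<le> e / 2\<close> of
      \<open>x\<close>.\<close>
    have "\<exists>z>x. z < x + h \<and> \<Phi> (x + h) - \<Phi> x = (x + h - x) * F z"
      by (rule MVT2) (use that h in \<open>auto intro!: d\<Phi>\<close>)
    then obtain z where z: "x < z" "z < x + h" "\<Phi> (x + h) - \<Phi> x = h * F z" by auto
    then have "f x = F z" using h by (simp add: f_def)
    then show ?thesis using lip[of z x] z h by linarith
  qed
  have f'_le: "\<bar>f' x\<bar> \<le> 1" for x
    using lip[of "x + h" x] h by (simp add: f'_def field_simps)
  \<comment> \<open>\<open>d \<le> e\<close> bounds the error of the slope, and
    \<open>d * r \<le> e / 2\<close> the error accumulated by integrating from 0, where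
    \<open>G\<close> is normalised to agree with \<open>f\<close>.\<close>
  define d where "d = min e (e / (2 * r))"
  have d: "d > 0" "d \<le> e" "d * r \<le> e / 2"
    using \<open>0 < e\<close> r by (auto simp: d_def min_def field_simps split: if_splits)
  obtain p where p: "real_polynomial_function p" "\<And>x. x \<in> {-r..r} \<Longrightarrow> \<bar>f' x - p x\<bar> < d"
  proof (rule Stone_Weierstrass_real_polynomial_function[of "{-r..r}" f' d])
    show "continuous_on {-r..r} f'"
      unfolding f'_def using h
      by (intro continuous_intros continuous_on_compose2[OF contF[of UNIV]]) auto
  qed (use d in auto)
  obtain P where P: "P \<in> elementary" "\<And>x. (P has_real_derivative p x) (at x)"
    using real_polynomial_antiderivative[OF p(1)] by blast
  define G where "G = (\<lambda>x. P x + (f 0 - P 0))"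
  have G: "G \<in> elementary" unfolding G_def by (intro elementary_intros P)
  have dG: "(G has_real_derivative p x) (at x)" for x
    unfolding G_def by (auto intro!: derivative_eq_intros P)
  have Gf: "\<bar>G x - f x\<bar> \<le> e / 2" if "\<bar>x\<bar> \<le> r" for x
  proof -
    have "norm ((G x - f x) - (G 0 - f 0)) \<le> d * norm (x - 0)"
    proof (rule field_differentiable_bound[of "{-r..r}" "\<lambda>x. G x - f x" "\<lambda>x. p x - f' x"])
      show "((\<lambda>x. G x - f x) has_field_derivative p x - f' x) (at x within {- r..r})"
        if "x \<in> {-r..r}" for x
        by (rule has_field_derivative_at_within)
          (use that in \<open>auto intro!: derivative_intros dG df\<close>)
      show "norm (p x - f' x) \<le> d" if "x \<in> {-r..r}" for x
        using p(2)[OF that] by auto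
    qed (use that r in auto)
    also have "\<dots> \<le> d * r" using that d by auto
    finally show ?thesis using d by (simp add: G_def)
  qed
  show ?thesis
  proof
    show "G \<in> elementary" by fact
    show "\<bar>G x - F x\<bar> \<le> e" if "\<bar>x\<bar> \<le> R" for x
      using Gf[of x] f_close[of x] that r by linarith
    show "\<bar>deriv G x\<bar> \<le> 1 + e" if "\<bar>x\<bar> \<le> R" for x
    proof -
      have "\<bar>f' x - p x\<bar> < d" by (rule p(2)) (use that r in auto)
      then show ?thesis
        using DERIV_imp_deriv[OF dG, of x] f'_le[of x] d by linarith
    qed
  qed
qed

text \<open>A zero with nonzero derivative is isolated among the zeros, and by Lindelof a set of
  isolated points is countable, hence null. This makes derivatives of smooth representatives agree
  almost everywhere where the representatives do.\<close>

lemma AE_deriv_eq_0: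
  fixes w :: "real \<Rightarrow> real"
  assumes "\<And>x. w differentiable at x"
  shows "AE x in lebesgue. w x = 0 \<longrightarrow> deriv w x = 0"
proof -
  define A where "A = {x. w x = 0 \<and> deriv w x \<noteq> 0}"
  have iso: "\<exists>U. open U \<and> x \<in> U \<and> U \<inter> A = {x}" if "x \<in> A" for x
  proof -
    have d: "(w has_real_derivative deriv w x) (at x)"
      using assms[of x] by (metis DERIV_imp_deriv real_differentiableE)
    then have "((\<lambda>y. (w y - w x) / (y - x)) \<longlongrightarrow> deriv w x) (at x)"
      by (simp add: has_field_derivative_iff)
    then have "\<forall>\<^sub>F y in at x. (w y - w x) / (y - x) \<noteq> 0"
      using that by (intro tendsto_imp_eventually_ne) (auto simp: A_def)
    then obtain U where "open U" "x \<in> U" "\<And>y. y \<in> U \<Longrightarrow> y \<noteq> x \<Longrightarrow> (w y - w x) / (y - x) \<noteq> 0"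
      unfolding eventually_at_topological by blast
    moreover from this that have "U \<inter> A = {x}"
      by (fastforce simp: A_def)
    ultimately show ?thesis by blast
  qed
  then obtain U where U: "\<And>x. x \<in> A \<Longrightarrow> open (U x) \<and> x \<in> U x \<and> U x \<inter> A = {x}"
    by metis
  obtain \<F> where \<F>: "\<F> \<subseteq> U ` A" "countable \<F>" "\<Union>\<F> = \<Union>(U ` A)"
  proof (rule Lindelof[of "U ` A"])
    show "open V" if "V \<in> U ` A" for V using that U by auto
  qed
  have "A \<subseteq> (\<Union>V\<in>\<F>. V \<inter> A)"
  proof
    fix x assume "x \<in> A"
    with U have "x \<in> \<Union>(U ` A)" by blast
    with \<open>x \<in> A\<close> \<F>(3) show "x \<in> (\<Union>V\<in>\<F>. V \<inter> A)" by auto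
  qed
  moreover have "countable (\<Union>V\<in>\<F>. V \<inter> A)"
  proof (intro countable_UN \<F>(2))
    fix V assume "V \<in> \<F>"
    then obtain x where "x \<in> A" "V = U x" using \<F>(1) by blast
    with U[of x] show "countable (V \<inter> A)" by simp
  qed
  ultimately have "countable A" by (rule countable_subset)
  then have "A \<in> null_sets lborel" by (rule countable_imp_null_set_lborel)
  then have "AE x in lborel. x \<notin> A" by (rule AE_not_in)
  then have "AE x in lebesgue. x \<notin> A" by (rule AE_completion)
  then show ?thesis by eventually_elim (auto simp: A_def)
qed

section \<open>Substitution by the cumulative mass\<close>

text \<open>The difference quotients are at most a multiple of the step length, so the derivative is
  0 everywhere.\<close>

lemma constant_if_quadratic_modulus:
  fixes H :: "real \<Rightarrow> real"
  assumes "\<And>s t. s < t \<Longrightarrow> \<bar>H t - H s\<bar> \<le> L * (t - s)\<^sup>2"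
  shows "H x = H y"
proof -
  have less: "\<bar>H t - H s\<bar> \<le> \<bar>L\<bar> * (t - s)\<^sup>2" if "s < t" for s t
    by (rule order_trans[OF assms[OF that]]) (intro mult_right_mono, auto)
  have modulus: "\<bar>H t - H s\<bar> \<le> \<bar>L\<bar> * (t - s)\<^sup>2" for s t
  proof (cases s t rule: linorder_cases)
    case greater
    then show ?thesis
      using less[of t s] by (simp only: abs_minus_commute[of "H s"] power2_commute[of s])
  qed (use less in auto)
  have "(H has_real_derivative 0) (at x)" for x
  proof -
    have "((\<lambda>y. (H y - H x) / (y - x)) \<longlongrightarrow> 0) (at x)"
    proof (rule Lim_null_comparison)
      show "((\<lambda>y. \<bar>L\<bar> * \<bar>y - x\<bar>) \<longlongrightarrow> 0) (at x)"
        by (rule tendsto_eq_rhs[of _ "\<bar>L\<bar> * \<bar>x - x\<bar>"]) (intro tendsto_intros, simp)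
      show "\<forall>\<^sub>F y in at x. norm ((H y - H x) / (y - x)) \<le> \<bar>L\<bar> * \<bar>y - x\<bar>"
        unfolding eventually_at_filter
      proof (intro always_eventually allI impI)
        fix y assume "y \<noteq> x"
        then show "norm ((H y - H x) / (y - x)) \<le> \<bar>L\<bar> * \<bar>y - x\<bar>"
          using modulus[where s = x and t = y]
            by (simp add: divide_le_eq power2_eq_square mult.assoc abs_mult_self_eq)
      qed
    qed
    then show ?thesis by (simp add: has_field_derivative_iff)
  qed
  then show ?thesis using DERIV_isconst_all by blast
qed

text \<open>Dominated convergence: at each point the truncated integrand is eventually constant in
  \<open>t\<close>.\<close>

lemma tendsto_integral_atMost:
  fixes g :: "real \<Rightarrow> real"
  assumes "integrable lebesgue g"
  shows "((\<lambda>t. \<integral>x. g x * indicator {..t} x \<partial>lebesgue) \<longlongrightarrow> (\<integral>x. g x \<partial>lebesgue)) at_top"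
    and "((\<lambda>t. \<integral>x. g x * indicator {..-t} x \<partial>lebesgue) \<longlongrightarrow> 0) at_top"
proof -
  have meas[measurable]: "g \<in> borel_measurable lebesgue" using assms by auto
  have ind[measurable]: "{..t::real} \<in> sets lebesgue" for t by simp
  show "((\<lambda>t. \<integral>x. g x * indicator {..t} x \<partial>lebesgue) \<longlongrightarrow> (\<integral>x. g x \<partial>lebesgue)) at_top"
  proof (rule integral_dominated_convergence_at_top[where w = "\<lambda>x. norm (g x)"])
    show "AE x in lebesgue. ((\<lambda>t. g x * indicator {..t} x) \<longlongrightarrow> g x) at_top"
    proof (intro AE_I2 tendsto_eventually)
      fix x show "\<forall>\<^sub>F t in at_top. g x * indicator {..t} x = g x"
        using eventually_ge_at_top[of x] by eventually_elim auto
    qed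
  qed (use assms in \<open>auto split: split_indicator\<close>)
  have "((\<lambda>t. \<integral>x. g x * indicator {..-t} x \<partial>lebesgue) \<longlongrightarrow> (\<integral>x. 0 \<partial>(lebesgue::real measure))) at_top"
  proof (rule integral_dominated_convergence_at_top[where w = "\<lambda>x. norm (g x)"])
    show "AE x in lebesgue. ((\<lambda>t. g x * indicator {..-t} x) \<longlongrightarrow> 0) at_top"
    proof (intro AE_I2 tendsto_eventually)
      fix x show "\<forall>\<^sub>F t in at_top. g x * indicator {..-t} x = 0"
        using eventually_gt_at_top[of "- x"] by eventually_elim auto
    qed
  qed (use assms in \<open>auto split: split_indicator\<close>)
  then show "((\<lambda>t. \<integral>x. g x * indicator {..-t} x \<partial>lebesgue) \<longlongrightarrow> 0) at_top"
    by simp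
qed

lemma continuous_imp_measurable_lebesgue:
  fixes f :: "real \<Rightarrow> real"
  assumes "continuous_on UNIV f"
  shows "f \<in> borel_measurable lebesgue"
  using borel_measurable_continuous_onI[OF assms] by (simp add: measurable_completion)

lemma elementary_continuous: "f \<in> elementary \<Longrightarrow> continuous_on A f"
  by (meson DERIV_continuous continuous_at_imp_continuous_on elementary_DERIV)

lemma cos_lipschitz: "\<bar>cos x - cos y\<bar> \<le> \<bar>x - y\<bar>" for x y :: real
proof -
  have "norm (cos x - cos y) \<le> 1 * norm (x - y)"
    by (rule field_differentiable_bound[of UNIV cos "\<lambda>x. - sin x"])
      (auto intro!: derivative_eq_intros)
  then show ?thesis by simp
qed

lemma sin_lipschitz: "\<bar>sin x - sin y\<bar> \<le> \<bar>x - y\<bar>" for x y :: real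
proof -
  have "norm (sin x - sin y) \<le> 1 * norm (x - y)"
    by (rule field_differentiable_bound[of UNIV sin cos])
      (auto intro!: derivative_eq_intros)
  then show ?thesis by simp
qed

section \<open>The cumulative mass of a density\<close>

locale mass_density =
  fixes \<rho> :: "real \<Rightarrow> real"
  assumes integrable: "integrable lebesgue \<rho>"
    and bounds: "\<And>x. 0 \<le> \<rho> x \<and> \<rho> x \<le> 1"
    and not_null: "\<not> (AE x in lebesgue. \<rho> x = 0)"
begin

text \<open>\<open>mass\<close> and \<open>cumul\<close> are the \<open>M\<close> and
  \<open>F\<close> of the overview.\<close>

definition mass :: real where "mass = (\<integral>x. \<rho> x \<partial>lebesgue)"

definition cumul :: "real \<Rightarrow> real" where
  "cumul s = (\<integral>x. \<rho> x * indicator {..s} x \<partial>lebesgue)"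

lemma nonneg: "0 \<le> \<rho> x" and le_1: "\<rho> x \<le> 1"
  using bounds by auto

lemma measurable[measurable]: "\<rho> \<in> borel_measurable lebesgue"
  using integrable by auto

lemma mass_pos: "mass > 0"
  using integral_nonneg_eq_0_iff_AE[OF integrable] not_null nonneg
    Bochner_Integration.integral_nonneg[of lebesgue \<rho>] unfolding mass_def by (auto simp: order_less_le)

lemma integrable_weighted:
  assumes "w \<in> borel_measurable lebesgue" "\<And>x. \<bar>w x\<bar> \<le> C"
  shows "integrable lebesgue (\<lambda>x. \<rho> x * w x)"
proof (rule Bochner_Integration.integrable_bound[of _ "\<lambda>x. C * \<rho> x"])
  show "AE x in lebesgue. norm (\<rho> x * w x) \<le> norm (C * \<rho> x)"
  proof (rule AE_I2)
    fix x have "\<bar>w x\<bar> \<le> \<bar>C\<bar>" using assms(2)[of x] by linarith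
    then show "norm (\<rho> x * w x) \<le> norm (C * \<rho> x)"
      using mult_left_mono[of "\<bar>w x\<bar>" "\<bar>C\<bar>" "\<rho> x"] nonneg[of x]
      by (simp add: abs_mult mult.commute)
  qed
qed (use integrable assms(1) in auto)

lemma integrable_weighted_indicator:
  assumes "w \<in> borel_measurable lebesgue" "\<And>x. \<bar>w x\<bar> \<le> C" "A \<in> sets lebesgue"
  shows "integrable lebesgue (\<lambda>x. \<rho> x * w x * indicator A x)"
  using integrable_mult_indicator[OF assms(3) integrable_weighted[OF assms(1,2)]]
  by (simp add: mult.commute)

lemma weighted_increment:
  assumes "w \<in> borel_measurable lebesgue" "\<And>x. \<bar>w x\<bar> \<le> C" "s \<le> t"
  shows "(\<integral>x. \<rho> x * w x * indicator {..t} x \<partial>lebesgue) - (\<integral>x. \<rho> x * w x * indicator {..s} x \<partial>lebesgue)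
    = (\<integral>x. \<rho> x * w x * indicator {s<..t} x \<partial>lebesgue)"
proof -
  have "(\<integral>x. \<rho> x * w x * indicator {..t} x \<partial>lebesgue) - (\<integral>x. \<rho> x * w x * indicator {..s} x \<partial>lebesgue)
    = (\<integral>x. \<rho> x * w x * indicator {..t} x - \<rho> x * w x * indicator {..s} x \<partial>lebesgue)"
    by (intro Bochner_Integration.integral_diff[symmetric] integrable_weighted_indicator[OF assms(1,2)]) auto
  also have "\<dots> = (\<integral>x. \<rho> x * w x * indicator {s<..t} x \<partial>lebesgue)"
    using assms(3) by (intro Bochner_Integration.integral_cong) (auto split: split_indicator)
  finally show ?thesis .
qed

lemma cumul_increment:
  assumes "s \<le> t"
  shows "cumul t - cumul s = (\<integral>x. \<rho> x * indicator {s<..t} x \<partial>lebesgue)"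
  using weighted_increment[of "\<lambda>_. 1" 1 s t] assms by (simp add: cumul_def)

lemma cumul_mono: "s \<le> t \<Longrightarrow> cumul s \<le> cumul t"
proof -
  assume "s \<le> t"
  then have "cumul t - cumul s \<ge> 0"
    unfolding cumul_increment[OF \<open>s \<le> t\<close>] by (intro Bochner_Integration.integral_nonneg) (simp add: nonneg)
  then show ?thesis by simp
qed

lemma cumul_increment_le:
  assumes "s \<le> t"
  shows "cumul t - cumul s \<le> t - s"
proof -
  have "cumul t - cumul s \<le> (\<integral>x. indicator {s<..t} x \<partial>(lebesgue :: real measure))"
    unfolding cumul_increment[OF assms]
  proof (rule integral_mono)
    show "integrable lebesgue (\<lambda>x. \<rho> x * indicator {s<..t} x)"
      using integrable_weighted_indicator[of "\<lambda>_. 1" 1 "{s<..t}"] by simp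
    show "\<rho> x * indicator {s<..t} x \<le> indicator {s<..t} x" for x
      by (simp add: le_1 split: split_indicator)
    show "integrable lebesgue (indicator {s<..t} :: real \<Rightarrow> real)"
      using assms by (intro integrable_real_indicator) (auto simp: top_unique less_top[symmetric])
  qed
  also have "\<dots> = t - s" using assms by simp
  finally show ?thesis .
qed

lemma cumul_lipschitz: "\<bar>cumul x - cumul y\<bar> \<le> \<bar>x - y\<bar>"
  using cumul_mono[of x y] cumul_mono[of y x] cumul_increment_le[of x y] cumul_increment_le[of y x]
  by linarith

lemma cumul_bounds: "0 \<le> cumul s" "cumul s \<le> mass"
proof -
  show "0 \<le> cumul s" unfolding cumul_def by (intro Bochner_Integration.integral_nonneg) (simp add: nonneg)
  have "integrable lebesgue (\<lambda>x. \<rho> x * indicator {..s} x)"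
    using integrable_weighted_indicator[of "\<lambda>_. 1" 1 "{..s}"] by simp
  then show "cumul s \<le> mass" unfolding cumul_def mass_def
    by (intro integral_mono integrable) (auto simp: nonneg split: split_indicator)
qed

lemma cumul_continuous: "continuous_on A cumul"
  by (rule lipschitz_continuous_on[of _ 1]) (simp add: cumul_lipschitz)

text \<open>
  Lipschitz continuity of \<open>q\<close> replaces differentiability of \<^term>\<open>cumul\<close> almost everywhere:
  the two sides, as functions of an upper integration limit, differ by a function with a
  quadratic modulus of continuity, that is, by a constant.
\<close>

lemma integral_substitution_cumul:
  assumes lip: "\<And>x y. \<bar>q x - q y\<bar> \<le> L * \<bar>x - y\<bar>"
    and Q: "\<And>x. (Q has_real_derivative q x) (at x)"
  shows "(\<integral>x. \<rho> x * q (cumul x) \<partial>lebesgue) = Q mass - Q 0"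
proof -
  have L: "L \<ge> 0" using lip[of 0 1] by simp
  have contq: "continuous_on UNIV q" by (rule lipschitz_continuous_on[OF lip])
  have meas: "(\<lambda>x. q (cumul x)) \<in> borel_measurable lebesgue"
    by (intro continuous_imp_measurable_lebesgue continuous_on_compose2[OF contq cumul_continuous]) auto
  have bnd: "\<bar>q (cumul x)\<bar> \<le> \<bar>q 0\<bar> + L * mass" for x
  proof -
    have "\<bar>q (cumul x) - q 0\<bar> \<le> L * \<bar>cumul x\<bar>" using lip[of "cumul x" 0] by simp
    also have "\<dots> \<le> L * mass" using cumul_bounds[of x] L by (intro mult_left_mono) auto
    finally show ?thesis by linarith
  qed
  define I where "I s = (\<integral>x. \<rho> x * q (cumul x) * indicator {..s} x \<partial>lebesgue)" for s
  define H where "H s = I s - Q (cumul s)" for s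
  have "\<bar>H t - H s\<bar> \<le> L * (t - s)\<^sup>2" if "s < t" for s t
  proof -
    \<comment> \<open>The integrand is compared with its frozen value \<open>q z\<close> on
      \<open>{s<..t}\<close>: there the two differ by at most \<open>L * (t - s)\<close>, and the
      mass of the interval is at most \<open>t - s\<close>. If the interval has no mass,
      \<open>z = cumul s\<close> serves.\<close>
    obtain z where z: "cumul s \<le> z" "z \<le> cumul t"
      "Q (cumul t) - Q (cumul s) = (cumul t - cumul s) * q z"
    proof (cases "cumul s = cumul t")
      case False
      then have "cumul s < cumul t" using cumul_mono[of s t] \<open>s < t\<close> by linarith
      then obtain z where "cumul s < z" "z < cumul t" 
        "Q (cumul t) - Q (cumul s) = (cumul t - cumul s) * q z"
        using MVT2[of "cumul s" "cumul t" Q q] Q by blast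
      then show ?thesis by (intro that[of z]) auto
    qed (use that in auto)
    have int1: "integrable lebesgue (\<lambda>x. \<rho> x * q (cumul x) * indicator {s<..t} x)"
      by (rule integrable_weighted_indicator[OF meas bnd]) auto
    have int2: "integrable lebesgue (\<lambda>x. \<rho> x * indicator {s<..t} x)"
      using integrable_weighted_indicator[of "\<lambda>_. 1" 1 "{s<..t}"] by simp
    have "H t - H s = (\<integral>x. \<rho> x * q (cumul x) * indicator {s<..t} x \<partial>lebesgue)
        - q z * (\<integral>x. \<rho> x * indicator {s<..t} x \<partial>lebesgue)"
      using weighted_increment[OF meas bnd, of s t] cumul_increment[of s t] that z(3)
      by (simp add: H_def I_def algebra_simps)
    also have "\<dots> = (\<integral>x. \<rho> x * q (cumul x) * indicator {s<..t} x
        - q z * (\<rho> x * indicator {s<..t} x) \<partial>lebesgue)"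
      using int1 int2 by simp
    finally have "\<bar>H t - H s\<bar> = norm (\<integral>x. \<rho> x * q (cumul x) * indicator {s<..t} x
        - q z * (\<rho> x * indicator {s<..t} x) \<partial>lebesgue)" by simp
    also have "\<dots> \<le> (\<integral>x. (L * (t - s)) * (\<rho> x * indicator {s<..t} x) \<partial>lebesgue)"
    proof (rule Bochner_Integration.integral_norm_bound_integral)
      fix x
      show "norm (\<rho> x * q (cumul x) * indicator {s<..t} x - q z * (\<rho> x * indicator {s<..t} x))
        \<le> (L * (t - s)) * (\<rho> x * indicator {s<..t} x)"
      proof (cases "x \<in> {s<..t}")
        case True
        then have "cumul s \<le> cumul x" "cumul x \<le> cumul t" using cumul_mono by auto
        then have "\<bar>cumul x - z\<bar> \<le> t - s"
          using z cumul_increment_le[of s t] that by linarith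
        then have "\<bar>q (cumul x) - q z\<bar> \<le> L * (t - s)"
          using order_trans[OF lip mult_left_mono[OF _ L]] by blast
        from mult_left_mono[OF this nonneg[of x]]
        have "\<bar>\<rho> x * (q (cumul x) - q z)\<bar> \<le> \<rho> x * (L * (t - s))"
          by (simp add: abs_mult nonneg)
        then show ?thesis using True by (simp add: algebra_simps)
      qed auto
    qed (use int1 int2 in auto)
    also have "\<dots> = (L * (t - s)) * (cumul t - cumul s)"
      using that int2 by (simp add: cumul_increment)
    also have "\<dots> \<le> (L * (t - s)) * (t - s)"
      using cumul_increment_le[of s t] that L by (intro mult_left_mono) auto
    finally show ?thesis by (simp add: power2_eq_square)
  qed
  then have const: "H s = H 0" for s by (rule constant_if_quadratic_modulus)
  have contQ: "isCont Q x" for x using Q DERIV_isCont by blast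
  note lim_I = tendsto_integral_atMost[OF integrable_weighted[OF meas bnd], folded I_def]
  note lim_c = tendsto_integral_atMost[OF integrable, folded cumul_def, folded mass_def]
  \<comment> \<open>The constant value of \<open>H\<close> is read off at both ends of the line:
    \<open>cumul\<close> tends to \<open>mass\<close> on the right and to 0 on the left.\<close>
  have "(H \<longlongrightarrow> (\<integral>x. \<rho> x * q (cumul x) \<partial>lebesgue) - Q mass) at_top"
    unfolding H_def by (intro tendsto_diff lim_I(1) isCont_tendsto_compose[OF contQ lim_c(1)])
  moreover have "((\<lambda>t. H (- t)) \<longlongrightarrow> 0 - Q 0) at_top"
    unfolding H_def by (intro tendsto_diff lim_I(2) isCont_tendsto_compose[OF contQ lim_c(2)])
  moreover have "H = (\<lambda>_. H 0)" "(\<lambda>t. H (- t)) = (\<lambda>_. H 0)" using const by auto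
  ultimately have "(\<integral>x. \<rho> x * q (cumul x) \<partial>lebesgue) - Q mass = 0 - Q 0"
    by (metis tendsto_const tendsto_unique trivial_limit_at_top_linorder)
  then show ?thesis by simp
qed

section \<open>Integrals of cosines in the cumulative mass\<close>

text \<open>The functions \<open>cos (freq * real j * t)\<close> are the Neumann eigenfunctions of
  the interval \<open>{0..mass}\<close>.\<close>

definition freq :: real where "freq = pi / mass"

lemma freq_pos: "freq > 0" using mass_pos by (simp add: freq_def)

text \<open>For \<open>n \<noteq> 0\<close> the antiderivative is a multiple of a sine that vanishes
  at 0 and, by the choice of \<open>freq\<close>, at \<open>mass\<close>. Integer \<open>n\<close>
  admits the differences of indices that product formulas produce.\<close>

lemma integral_cos_cumul:
  "(\<integral>x. \<rho> x * cos (freq * of_int n * cumul x) \<partial>lebesgue) = (if n = 0 then mass else 0)"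
proof (cases "n = 0")
  case False
  define b where "b = freq * of_int n"
  have b: "b \<noteq> 0" using False freq_pos by (simp add: b_def)
  have "(\<integral>x. \<rho> x * (cos (b * cumul x)) \<partial>lebesgue) = sin (b * mass) / b - sin (b * 0) / b"
  proof (rule integral_substitution_cumul)
    show "((\<lambda>x. sin (b * x) / b) has_real_derivative cos (b * x)) (at x)" for x
      using b by (auto intro!: derivative_eq_intros)
    show "\<bar>cos (b * x) - cos (b * y)\<bar> \<le> \<bar>b\<bar> * \<bar>x - y\<bar>" for x y
      using cos_lipschitz[of "b * x" "b * y"] by (simp add: abs_mult right_diff_distrib[symmetric])
  qed
  also have "b * mass = pi * of_int n" using mass_pos by (simp add: b_def freq_def)
  finally show ?thesis using False by (simp add: b_def)
qed (simp add: mass_def)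

end

section \<open>Trigonometric polynomials and cutoffs\<close>

definition cos_poly :: "real \<Rightarrow> nat \<Rightarrow> (nat \<Rightarrow> real) \<Rightarrow> real \<Rightarrow> real" where
  "cos_poly w k a t = (\<Sum>j\<le>k. a j * cos (w * real j * t))"

text \<open>This is minus the derivative of \<open>cos_poly w k a\<close>; the sign disappears in
  the squares that are integrated later.\<close>

definition sin_poly :: "real \<Rightarrow> nat \<Rightarrow> (nat \<Rightarrow> real) \<Rightarrow> real \<Rightarrow> real" where
  "sin_poly w k a t = (\<Sum>j\<le>k. a j * (w * real j) * sin (w * real j * t))"

lemma cos_poly_has_derivative:
  "(cos_poly w k a has_real_derivative - sin_poly w k a t) (at t)"
  unfolding cos_poly_def[abs_def] sin_poly_def sum_negf[symmetric]
  by (intro DERIV_sum) (auto intro!: derivative_eq_intros)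

lemma elementary_cos_poly:
  assumes "G \<in> elementary"
  shows "(\<lambda>x. cos_poly w k a (G x)) \<in> elementary"
  unfolding cos_poly_def by (intro elementary_intros assms)

text \<open>Reduces bounds on a sum to a bound for each mode, with the absolute sum of the
  coefficients as the common measure of size.\<close>

lemma abs_weighted_sum_le:
  fixes a b :: "nat \<Rightarrow> real"
  assumes "\<And>j. j \<le> k \<Longrightarrow> \<bar>b j\<bar> \<le> C"
  shows "\<bar>\<Sum>j\<le>k. a j * b j\<bar> \<le> C * (\<Sum>j\<le>k. \<bar>a j\<bar>)"
proof -
  have "\<bar>\<Sum>j\<le>k. a j * b j\<bar> \<le> (\<Sum>j\<le>k. \<bar>a j * b j\<bar>)" by (rule sum_abs)
  also have "\<dots> \<le> (\<Sum>j\<le>k. C * \<bar>a j\<bar>)"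
  proof (rule sum_mono)
    fix j assume "j \<in> {..k}"
    then show "\<bar>a j * b j\<bar> \<le> C * \<bar>a j\<bar>"
      using mult_right_mono[OF assms[of j], of "\<bar>a j\<bar>"] by (simp add: abs_mult mult.commute)
  qed
  finally show ?thesis by (simp add: sum_distrib_left)
qed

lemma abs_cos_poly_le: "\<bar>cos_poly w k a t\<bar> \<le> (\<Sum>j\<le>k. \<bar>a j\<bar>)"
  unfolding cos_poly_def using abs_weighted_sum_le[of k "\<lambda>j. cos (w * real j * t)" 1 a] by simp

context
  fixes w :: real assumes w: "0 \<le> w"
begin

lemma abs_sin_poly_le: "\<bar>sin_poly w k a t\<bar> \<le> w * real k * (\<Sum>j\<le>k. \<bar>a j\<bar>)"
  unfolding sin_poly_def mult.assoc[of "a _"]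
proof (rule abs_weighted_sum_le)
  fix j assume "j \<le> k"
  have "(w * real j) * \<bar>sin (w * (real j * t))\<bar> \<le> (w * real k) * 1"
    using w \<open>j \<le> k\<close> by (intro mult_mono) auto
  then show "\<bar>w * real j * sin (w * real j * t)\<bar> \<le> w * real k"
    using w by (simp add: abs_mult mult.assoc)
qed

lemma cos_poly_lipschitz:
  "\<bar>cos_poly w k a s - cos_poly w k a t\<bar> \<le> w * real k * \<bar>s - t\<bar> * (\<Sum>j\<le>k. \<bar>a j\<bar>)"
  unfolding cos_poly_def sum_subtractf[symmetric] right_diff_distrib[symmetric]
proof (rule abs_weighted_sum_le)
  fix j assume "j \<le> k"
  have "\<bar>cos (w * real j * s) - cos (w * real j * t)\<bar> \<le> w * real j * \<bar>s - t\<bar>"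
    using cos_lipschitz[of "w * real j * s" "w * real j * t"] w
    by (simp add: right_diff_distrib[symmetric] abs_mult)
  also have "\<dots> \<le> w * real k * \<bar>s - t\<bar>"
    using w \<open>j \<le> k\<close> by (intro mult_right_mono mult_left_mono) auto
  finally show "\<bar>cos (w * real j * s) - cos (w * real j * t)\<bar> \<le> w * real k * \<bar>s - t\<bar>" .
qed

lemma sin_poly_lipschitz:
  "\<bar>sin_poly w k a s - sin_poly w k a t\<bar> \<le> (w * real k)\<^sup>2 * \<bar>s - t\<bar> * (\<Sum>j\<le>k. \<bar>a j\<bar>)"
  unfolding sin_poly_def sum_subtractf[symmetric] right_diff_distrib[symmetric] mult.assoc[of "a _"]
proof (rule abs_weighted_sum_le)
  fix j assume "j \<le> k"
  have "\<bar>sin (w * real j * s) - sin (w * real j * t)\<bar> \<le> w * real j * \<bar>s - t\<bar>"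
    using sin_lipschitz[of "w * real j * s" "w * real j * t"] w
    by (simp add: right_diff_distrib[symmetric] abs_mult)
  then have "\<bar>w * real j * (sin (w * real j * s) - sin (w * real j * t))\<bar>
      \<le> (w * real j) * (w * real j * \<bar>s - t\<bar>)"
    using w by (simp add: abs_mult mult_left_mono)
  also have "\<dots> \<le> (w * real k) * (w * real k * \<bar>s - t\<bar>)"
    using w \<open>j \<le> k\<close> by (intro mult_mono mult_right_mono mult_left_mono) auto
  finally show "\<bar>w * real j * (sin (w * real j * s) - sin (w * real j * t))\<bar>
      \<le> (w * real k)\<^sup>2 * \<bar>s - t\<bar>" by (simp add: power2_eq_square mult.assoc)
qed

end

section \<open>Slowly varying cutoffs\<close>

text \<open>The factor \<open>exp 1\<close> normalises the value at 0 to 1, which is also the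
  maximum.\<close>

definition bump :: "real \<Rightarrow> real" where
  "bump x = exp 1 * flat_exp 0 (1 - x\<^sup>2)"

lemma bump_elementary:
  assumes "f \<in> elementary" shows "(\<lambda>x. bump (f x)) \<in> elementary"
  unfolding bump_def by (intro elementary_intros assms)

lemma bump_0: "bump 0 = 1"
  by (simp add: bump_def flat_exp_def exp_minus)

lemma bump_eq_0: "1 \<le> \<bar>x\<bar> \<Longrightarrow> bump x = 0"
  using one_le_power[of "\<bar>x\<bar>" 2] by (simp add: bump_def flat_exp_def)

lemma bump_nonneg: "0 \<le> bump x"
  by (simp add: bump_def flat_exp_def)

lemma bump_le_1: "bump x \<le> 1"
proof (cases "x\<^sup>2 < 1")
  case True
  then have "1 / (1 - x\<^sup>2) \<ge> 1" by (simp add: field_simps)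
  then show ?thesis using True by (simp add: bump_def flat_exp_def exp_add[symmetric])
qed (simp add: bump_def flat_exp_def)

text \<open>Compactness gives a bound on \<open>{-1..1}\<close>, and outside that interval the
  derivative is 0.\<close>

lemma deriv_bump_bounded:
  obtains B where "B > 0" "\<And>x. \<bar>deriv bump x\<bar> \<le> B"
proof -
  have el: "bump \<in> elementary" using bump_elementary[OF elementary.ident] by simp
  have "compact (deriv bump ` {-1..1})"
    by (intro compact_continuous_image elementary_continuous elementary_deriv el) auto
  then obtain B where B: "B > 0" "\<And>x. x \<in> {-1..1} \<Longrightarrow> \<bar>deriv bump x\<bar> \<le> B"
    using compact_imp_bounded bounded_pos[of "deriv bump ` {-1..1}"] by auto
  have "deriv bump x = 0" if "1 < \<bar>x\<bar>" for x
  proof -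
    have "(bump has_real_derivative 0) (at x)"
      by (rule has_field_derivative_transform_within_open[of "\<lambda>_. 0" _ _ "- {-1..1}"])
        (use that bump_eq_0 in \<open>auto simp: open_Compl\<close>)
    then show ?thesis by (rule DERIV_imp_deriv)
  qed
  then have "\<bar>deriv bump x\<bar> \<le> B" for x
    using B(1) B(2)[of x] by (cases "\<bar>x\<bar> \<le> 1") (auto simp: abs_le_iff)
  with B that show ?thesis by blast
qed

context mass_density
begin

lemma integrable_weighted_elementary:
  assumes "f \<in> elementary" "\<And>x. \<bar>f x\<bar> \<le> C"
  shows "integrable lebesgue (\<lambda>x. \<rho> x * f x)"
  using assms
  by (intro integrable_weighted continuous_imp_measurable_lebesgue elementary_continuous) auto

text \<open>Dilating the bump by a large factor \<open>r\<close> divides its slope by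
  \<open>r\<close>. The bump then tends pointwise to \<open>bump 0 = 1\<close>, so dominated
  convergence with bound \<open>\<rho>\<close> makes the lost mass small.\<close>

lemma cutoff_exists:
  assumes "e > 0"
  obtains \<psi> R where "\<psi> \<in> elementary" "\<And>x. R \<le> \<bar>x\<bar> \<Longrightarrow> \<psi> x = 0" "\<And>x. 0 \<le> \<psi> x" "\<And>x. \<psi> x \<le> 1"
    "\<And>x. \<bar>deriv \<psi> x\<bar> \<le> e" "(\<integral>x. \<rho> x * (1 - (\<psi> x)\<^sup>2) \<partial>lebesgue) \<le> e"
proof -
  obtain B where B: "B > 0" "\<And>x. \<bar>deriv bump x\<bar> \<le> B" using deriv_bump_bounded by blast
  have el: "(\<lambda>x. bump (inverse r * x)) \<in> elementary" for r
    by (intro bump_elementary elementary_intros)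
  have cont: "isCont bump x" for x
    using bump_elementary[OF elementary.ident] elementary_DERIV DERIV_isCont by blast
  have sq: "\<bar>1 - (bump x)\<^sup>2\<bar> \<le> 1" for x
    using bump_nonneg[of x] bump_le_1[of x] power_le_one[of "bump x" 2] by simp
  have "((\<lambda>r. \<integral>x. \<rho> x * (1 - (bump (inverse r * x))\<^sup>2) \<partial>lebesgue) \<longlongrightarrow> (\<integral>x. 0 \<partial>(lebesgue::real measure))) at_top"
  proof (rule integral_dominated_convergence_at_top[where w = "\<lambda>x. \<rho> x"])
    show "(\<lambda>x. \<rho> x * (1 - (bump (inverse r * x))\<^sup>2)) \<in> borel_measurable lebesgue" for r
      by (rule borel_measurable_integrable, rule integrable_weighted_elementary[of _ 1])
        (intro elementary_intros el sq)+
    show "\<forall>\<^sub>F r in at_top. AE x in lebesgue. norm (\<rho> x * (1 - (bump (inverse r * x))\<^sup>2)) \<le> \<rho> x"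
      using mult_left_mono[OF sq nonneg] by (auto simp: abs_mult nonneg)
    show "AE x in lebesgue. ((\<lambda>r. \<rho> x * (1 - (bump (inverse r * x))\<^sup>2)) \<longlongrightarrow> 0) at_top"
    proof (rule AE_I2)
      fix x :: real
      have "((\<lambda>r::real. inverse r) \<longlongrightarrow> 0) at_top"
        by (rule tendsto_inverse_0_at_top) (rule filterlim_ident)
      then have "((\<lambda>r. inverse r * x) \<longlongrightarrow> 0 * x) at_top"
        by (rule tendsto_mult) (rule tendsto_const)
      then have "((\<lambda>r. bump (inverse r * x)) \<longlongrightarrow> bump 0) at_top"
        using isCont_tendsto_compose[OF cont] by simp
      then have "((\<lambda>r. \<rho> x * (1 - (bump (inverse r * x))\<^sup>2)) \<longlongrightarrow> \<rho> x * (1 - (bump 0)\<^sup>2)) at_top"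
        by (intro tendsto_intros)
      then show "((\<lambda>r. \<rho> x * (1 - (bump (inverse r * x))\<^sup>2)) \<longlongrightarrow> 0) at_top"
        by (simp add: bump_0)
    qed
  qed (use integrable in auto)
  then have "\<forall>\<^sub>F r in at_top. (\<integral>x. \<rho> x * (1 - (bump (inverse r * x))\<^sup>2) \<partial>lebesgue) < e"
    using \<open>e > 0\<close> by (simp add: order_tendstoD(2))
  \<comment> \<open>With slope bound \<open>B\<close> for the bump, \<open>r \<ge> B / e\<close>
    gives slope at most \<open>e\<close> after dilation; \<open>r \<ge> 1\<close> ensures
    positivity.\<close>
  moreover have "\<forall>\<^sub>F r in at_top. r \<ge> max 1 (B / e)" by (rule eventually_ge_at_top)
  ultimately have "\<forall>\<^sub>F r in at_top. (\<integral>x. \<rho> x * (1 - (bump (inverse r * x))\<^sup>2) \<partial>lebesgue) < e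
      \<and> r \<ge> max 1 (B / e)" by (rule eventually_conj)
  then obtain r where r: "(\<integral>x. \<rho> x * (1 - (bump (inverse r * x))\<^sup>2) \<partial>lebesgue) < e" "r \<ge> 1" "r \<ge> B / e"
    using eventually_happens'[OF trivial_limit_at_top_linorder] by fastforce
  show ?thesis
  proof
    show "(\<lambda>x. bump (inverse r * x)) \<in> elementary" by (rule el)
    show "bump (inverse r * x) = 0" if "r \<le> \<bar>x\<bar>" for x
      using that r by (intro bump_eq_0) (simp add: abs_mult field_simps)
    show "\<bar>deriv (\<lambda>x. bump (inverse r * x)) x\<bar> \<le> e" for x
    proof -
      have "((\<lambda>x. inverse r * x) has_real_derivative inverse r) (at x)"
        by (auto intro!: derivative_eq_intros)
      from DERIV_chain2[OF elementary_DERIV this, of bump]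
      have "((\<lambda>x. bump (inverse r * x)) has_real_derivative deriv bump (inverse r * x) * inverse r) (at x)"
        using bump_elementary[OF elementary.ident] by simp
      then have "\<bar>deriv (\<lambda>x. bump (inverse r * x)) x\<bar> = \<bar>deriv bump (inverse r * x)\<bar> * inverse r"
        using r by (simp add: DERIV_imp_deriv abs_mult)
      also have "\<dots> \<le> B * inverse r" using r B by (intro mult_right_mono) auto
      also have "\<dots> \<le> e" using r \<open>e > 0\<close> by (simp add: field_simps)
      finally show ?thesis .
    qed
  qed (use r bump_nonneg bump_le_1 in \<open>auto intro: less_imp_le\<close>)
qed

section \<open>Orthogonality with respect to the density\<close>

text \<open>Product formulas leave the frequencies \<open>i - j\<close> and \<open>i + j\<close>,
  and only frequency 0 survives integration. For \<open>i = j = 0\<close> both survive: they add up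
  to the full mass for cosines and cancel for sines.\<close>

lemma integral_cos_cos:
  "(\<integral>x. \<rho> x * (cos (freq * real i * cumul x) * cos (freq * real j * cumul x)) \<partial>lebesgue)
    = (if i = j then if i = 0 then mass else mass / 2 else 0)" (is "?L = _")
  and integral_sin_sin:
  "(\<integral>x. \<rho> x * (sin (freq * real i * cumul x) * sin (freq * real j * cumul x)) \<partial>lebesgue)
    = (if i = j \<and> i \<noteq> 0 then mass / 2 else 0)" (is "?L' = _")
proof -
  define c where "c n = (\<lambda>x. \<rho> x * cos (freq * of_int n * cumul x))" for n
  have int: "integrable lebesgue (c n)" for n
    unfolding c_def
    by (rule integrable_weighted[of _ 1])
      (auto intro!: continuous_imp_measurable_lebesgue continuous_intros cumul_continuous)
  have val: "integral\<^sup>L lebesgue (c n) = (if n = 0 then mass else 0)" for n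
    unfolding c_def by (rule integral_cos_cumul)
  have diff: "freq * real i * y - freq * real j * y = freq * of_int (int i - int j) * y" for y
    by (simp add: algebra_simps)
  have add: "freq * real i * y + freq * real j * y = freq * of_int (int i + int j) * y" for y
    by (simp add: algebra_simps)
  have "?L = (\<integral>x. (c (int i - int j) x + c (int i + int j) x) / 2 \<partial>lebesgue)"
    unfolding cos_times_cos diff add by (simp add: c_def algebra_simps add_divide_distrib)
  also have "\<dots> = (if i = j then if i = 0 then mass else mass / 2 else 0)"
    using int by (simp add: val)
  finally show "?L = (if i = j then if i = 0 then mass else mass / 2 else 0)" .
  have "?L' = (\<integral>x. (c (int i - int j) x - c (int i + int j) x) / 2 \<partial>lebesgue)"
    unfolding sin_times_sin diff add by (simp add: c_def algebra_simps diff_divide_distrib)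
  also have "\<dots> = (if i = j \<and> i \<noteq> 0 then mass / 2 else 0)"
    using int by (simp add: val)
  finally show "?L' = (if i = j \<and> i \<noteq> 0 then mass / 2 else 0)" .
qed

text \<open>Pythagoras for a finite orthogonal system, stated once for both the cosines and the
  sines.\<close>

lemma integral_orthogonal_square:
  fixes d m :: "nat \<Rightarrow> real"
  assumes cont: "\<And>j. continuous_on UNIV (b j)" and bnd: "\<And>j x. \<bar>b j x\<bar> \<le> 1"
    and orth: "\<And>i j. (\<integral>x. \<rho> x * (b i (cumul x) * b j (cumul x)) \<partial>lebesgue) = (if i = j then m i else 0)"
  shows "(\<integral>x. \<rho> x * (\<Sum>j\<le>k. d j * b j (cumul x))\<^sup>2 \<partial>lebesgue) = (\<Sum>j\<le>k. (d j)\<^sup>2 * m j)"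
proof -
  have int: "integrable lebesgue (\<lambda>x. \<rho> x * (b i (cumul x) * b j (cumul x)))" for i j
  proof (rule integrable_weighted)
    show "(\<lambda>x. b i (cumul x) * b j (cumul x)) \<in> borel_measurable lebesgue"
      by (intro continuous_imp_measurable_lebesgue continuous_on_mult
          continuous_on_compose2[OF cont cumul_continuous]) auto
    show "\<bar>b i (cumul x) * b j (cumul x)\<bar> \<le> 1" for x
      using mult_mono[OF bnd[of i "cumul x"] bnd[of j "cumul x"]] by (simp add: abs_mult)
  qed
  have "(\<integral>x. \<rho> x * (\<Sum>j\<le>k. d j * b j (cumul x))\<^sup>2 \<partial>lebesgue)
      = (\<integral>x. (\<Sum>i\<le>k. \<Sum>j\<le>k. d i * d j * (\<rho> x * (b i (cumul x) * b j (cumul x)))) \<partial>lebesgue)"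
    by (simp add: power2_eq_square sum_product sum_distrib_left algebra_simps)
  also have "\<dots> = (\<Sum>i\<le>k. \<Sum>j\<le>k. d i * d j * (if i = j then m i else 0))"
    using int by (simp add: Bochner_Integration.integral_sum orth)
  also have "\<dots> = (\<Sum>j\<le>k. (d j)\<^sup>2 * m j)"
  proof (rule sum.cong)
    fix i assume "i \<in> {..k}"
    have "(\<Sum>j\<le>k. d i * d j * (if i = j then m i else 0)) = (\<Sum>j\<le>k. if i = j then (d i)\<^sup>2 * m i else 0)"
      by (intro sum.cong) (auto simp: power2_eq_square)
    then show "(\<Sum>j\<le>k. d i * d j * (if i = j then m i else 0)) = (d i)\<^sup>2 * m i"
      using \<open>i \<in> {..k}\<close> by simp
  qed simp
  finally show ?thesis .
qed

text \<open>By orthogonality this is the squared weighted norm of the cosine sum composed with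
  \<open>cumul\<close>.\<close>

definition norm2 :: "nat \<Rightarrow> (nat \<Rightarrow> real) \<Rightarrow> real" where
  "norm2 k a = (\<Sum>j\<le>k. (a j)\<^sup>2 * (if j = 0 then mass else mass / 2))"

lemma integral_cos_poly: "(\<integral>x. \<rho> x * (cos_poly freq k a (cumul x))\<^sup>2 \<partial>lebesgue) = norm2 k a"
  unfolding cos_poly_def norm2_def
  by (rule integral_orthogonal_square[where b = "\<lambda>j t. cos (freq * real j * t)"])
    (auto intro!: continuous_intros simp: integral_cos_cos)

text \<open>The source of the eigenvalue bound: differentiation multiplies mode \<open>j\<close> by
  \<open>freq * real j\<close>, which is at most \<open>freq * real k\<close>, and removes the
  constant mode.\<close>

lemma integral_sin_poly_le:
  "(\<integral>x. \<rho> x * (sin_poly freq k a (cumul x))\<^sup>2 \<partial>lebesgue) \<le> (freq * real k)\<^sup>2 * norm2 k a"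
proof -
  have "(\<integral>x. \<rho> x * (sin_poly freq k a (cumul x))\<^sup>2 \<partial>lebesgue)
    = (\<Sum>j\<le>k. (a j * (freq * real j))\<^sup>2 * (if j \<noteq> 0 then mass / 2 else 0))"
    unfolding sin_poly_def
    by (rule integral_orthogonal_square[where b = "\<lambda>j t. sin (freq * real j * t)"])
      (auto intro!: continuous_intros simp: integral_sin_sin)
  also have "\<dots> \<le> (\<Sum>j\<le>k. (freq * real k)\<^sup>2 * ((a j)\<^sup>2 * (if j = 0 then mass else mass / 2)))"
  proof (rule sum_mono)
    fix j assume "j \<in> {..k}"
    then have "(freq * real j)\<^sup>2 \<le> (freq * real k)\<^sup>2"
      using freq_pos by (intro power_mono mult_left_mono) auto
    then have "(freq * real j)\<^sup>2 * ((a j)\<^sup>2 * (mass / 2)) \<le> (freq * real k)\<^sup>2 * ((a j)\<^sup>2 * (mass / 2))"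
      using mass_pos by (intro mult_right_mono) auto
    then show "(a j * (freq * real j))\<^sup>2 * (if j \<noteq> 0 then mass / 2 else 0)
      \<le> (freq * real k)\<^sup>2 * ((a j)\<^sup>2 * (if j = 0 then mass else mass / 2))"
      using mass_pos by (simp add: power_mult_distrib mult.assoc mult.left_commute)
  qed
  finally show ?thesis by (simp add: norm2_def sum_distrib_left)
qed

text \<open>Cauchy-Schwarz over the \<open>k + 1\<close> modes, each of weight at least
  \<open>mass / 2\<close>. It turns errors measured by the absolute sum of the coefficients into
  errors relative to \<open>norm2\<close>, uniformly in \<open>a\<close>.\<close>

lemma l1_squared_le_norm2:
  "(\<Sum>j\<le>k. \<bar>a j\<bar>)\<^sup>2 \<le> 2 * (real k + 1) / mass * norm2 k a"
proof -
  have "(\<Sum>j\<le>k. \<bar>a j\<bar> * 1)\<^sup>2 \<le> (\<Sum>j\<le>k. \<bar>a j\<bar>\<^sup>2) * (\<Sum>j\<le>k. 1\<^sup>2)"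
    by (rule Cauchy_Schwarz_ineq_sum)
  then have "(\<Sum>j\<le>k. \<bar>a j\<bar>)\<^sup>2 \<le> (real k + 1) * (\<Sum>j\<le>k. (a j)\<^sup>2)"
    by (simp add: mult.commute add.commute)
  also have "\<dots> \<le> (real k + 1) * (2 / mass * norm2 k a)"
    unfolding norm2_def sum_distrib_left[of "2 / mass"] using mass_pos
    by (intro mult_left_mono sum_mono) (auto simp: field_simps)
  finally show ?thesis by (simp add: algebra_simps)
qed

lemma norm2_pos:
  assumes "j \<le> k" "a j \<noteq> 0" shows "norm2 k a > 0"
  unfolding norm2_def using mass_pos assms by (intro sum_pos2[of _ j]) auto

end

section \<open>Trial subspaces\<close>

lemma restricted_class_add:
  "restricted_class \<rho> (\<lambda>x. f x + g x) = restricted_class \<rho> f + restricted_class \<rho> g"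
  by (simp add: restricted_class_def plus_ae_fun.abs_eq distrib_right)

lemma restricted_class_scaleR:
  "restricted_class \<rho> (\<lambda>x. c * f x) = c *\<^sub>R restricted_class \<rho> f"
  by (simp add: restricted_class_def scaleR_ae_fun.abs_eq mult.assoc)

lemma restricted_class_zero: "restricted_class \<rho> (\<lambda>x. 0) = 0"
  by (simp add: restricted_class_def zero_ae_fun_def)

lemma restricted_class_eq_iff:
  "restricted_class \<rho> f = restricted_class \<rho> g \<longleftrightarrow> (AE x in lebesgue. \<rho> x > 0 \<longrightarrow> f x = g x)"
proof -
  have "f x * indicator {y. \<rho> y > 0} x = g x * indicator {y. \<rho> y > 0} x \<longleftrightarrow> (\<rho> x > 0 \<longrightarrow> f x = g x)" for x
    by (auto split: split_indicator)
  then show ?thesis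
    by (simp add: restricted_class_def ae_fun.abs_eq_iff ae_eq_def)
qed

lemma test_function_differentiable:
  assumes "u \<in> test_functions"
  shows "u differentiable at x" "deriv u differentiable at x"
proof -
  have "(deriv ^^ n) u differentiable at x" for n using assms by (simp add: test_functions_def)
  from this[of 0] this[of 1] show "u differentiable at x" "deriv u differentiable at x" by auto
qed

text \<open>Representatives of one class agree almost everywhere on
  \<open>{x. \<rho> x > 0}\<close>, and by \<open>AE_deriv_eq_0\<close>, applied to their
  difference, so do their derivatives. Elsewhere the weight makes the integrands vanish.\<close>

lemma (in mass_density) rayleigh_cong:
  assumes u: "u \<in> test_functions" and v: "v \<in> test_functions"
    and eq: "restricted_class \<rho> u = restricted_class \<rho> v"
  shows "rayleigh \<rho> u = rayleigh \<rho> v"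
proof -
  have meas: "f \<in> borel_measurable lebesgue" "deriv f \<in> borel_measurable lebesgue"
    if "f \<in> test_functions" for f
    using test_function_differentiable[OF that]
    by (auto intro!: continuous_imp_measurable_lebesgue differentiable_imp_continuous_within
        simp: continuous_on_eq_continuous_within)
  have ae: "AE x in lebesgue. \<rho> x > 0 \<longrightarrow> u x = v x"
    using eq by (simp add: restricted_class_eq_iff)
  have d: "(f has_real_derivative deriv f x) (at x)" if "f \<in> test_functions" for f x
    using test_function_differentiable(1)[OF that, of x] by (metis DERIV_imp_deriv real_differentiableE)
  have diff: "((\<lambda>x. u x - v x) has_real_derivative deriv u x - deriv v x) (at x)" for x
    by (intro DERIV_diff d u v)
  then have "AE x in lebesgue. u x - v x = 0 \<longrightarrow> deriv (\<lambda>x. u x - v x) x = 0"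
    by (intro AE_deriv_eq_0) (auto simp: real_differentiable_def)
  then have ae': "AE x in lebesgue. \<rho> x > 0 \<longrightarrow> deriv u x = deriv v x"
    using ae by eventually_elim (simp add: DERIV_imp_deriv[OF diff])
  have "\<rho> x > 0 \<or> \<rho> x = 0" for x using nonneg[of x] by linarith
  then have *: "(\<rho> x > 0 \<longrightarrow> r = s) \<Longrightarrow> \<rho> x * r\<^sup>2 = \<rho> x * s\<^sup>2" for x r s by (metis mult_zero_left)
  have "(\<integral>x. \<rho> x * (u x)\<^sup>2 \<partial>lebesgue) = (\<integral>x. \<rho> x * (v x)\<^sup>2 \<partial>lebesgue)"
  proof (rule integral_cong_AE)
    show "AE x in lebesgue. \<rho> x * (u x)\<^sup>2 = \<rho> x * (v x)\<^sup>2"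
      using ae by eventually_elim (rule *)
  qed (use meas u v in \<open>auto intro!: borel_measurable_times borel_measurable_power\<close>)
  moreover have "(\<integral>x. \<rho> x * (deriv u x)\<^sup>2 \<partial>lebesgue) = (\<integral>x. \<rho> x * (deriv v x)\<^sup>2 \<partial>lebesgue)"
  proof (rule integral_cong_AE)
    show "AE x in lebesgue. \<rho> x * (deriv u x)\<^sup>2 = \<rho> x * (deriv v x)\<^sup>2"
      using ae' by eventually_elim (rule *)
  qed (use meas u v in \<open>auto intro!: borel_measurable_times borel_measurable_power\<close>)
  ultimately show ?thesis by (simp add: rayleigh_def)
qed

context mass_density
begin

text \<open>
  Bounds, per unit of the approximation error \<open>e\<close>, for the relative loss in the denominator of
  the Rayleigh quotient and the increase of its numerator; the factor \<open>2 * (k + 1) / mass\<close> comes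
  from comparing the absolute sum of the coefficients with \<^const>\<open>norm2\<close>.
\<close>

definition defect :: "nat \<Rightarrow> real" where
  "defect k = 2 * (real k + 1) / mass * (1 + 2 * (freq * real k) * mass)"

definition excess :: "nat \<Rightarrow> real" where
  "excess k = (let K = (freq * real k)\<^sup>2 + freq * real k + 1 in
     2 * (real k + 1) / mass * ((2 * (freq * real k) * K + K\<^sup>2) * mass))"

definition unit_coeff :: "nat \<Rightarrow> nat \<Rightarrow> real" where
  "unit_coeff i j = (if i = j then 1 else 0)"

section \<open>Estimates for a fixed approximation \<open>G\<close> and cutoff
  \<open>\<psi>\<close>\<close>

context
  fixes e R :: real and G \<psi> :: "real \<Rightarrow> real" and k :: nat
  assumes e: "0 < e" "e \<le> 1"
    and G: "G \<in> elementary" "\<And>x. \<bar>x\<bar> \<le> R \<Longrightarrow> \<bar>G x - cumul x\<bar> \<le> e"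
      "\<And>x. \<bar>x\<bar> \<le> R \<Longrightarrow> \<bar>deriv G x\<bar> \<le> 1 + e"
    and \<psi>: "\<psi> \<in> elementary" "\<And>x. R \<le> \<bar>x\<bar> \<Longrightarrow> \<psi> x = 0" "\<And>x. 0 \<le> \<psi> x" "\<And>x. \<psi> x \<le> 1"
      "\<And>x. \<bar>deriv \<psi> x\<bar> \<le> e" "(\<integral>x. \<rho> x * (1 - (\<psi> x)\<^sup>2) \<partial>lebesgue) \<le> e"
begin

definition trial :: "(nat \<Rightarrow> real) \<Rightarrow> real \<Rightarrow> real" where
  "trial a = (\<lambda>x. cos_poly freq k a (G x) * \<psi> x)"

lemma trial_elementary: "trial a \<in> elementary"
  unfolding trial_def by (intro elementary_intros elementary_cos_poly G \<psi>)

lemma trial_test_function: "trial a \<in> test_functions"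
  by (rule elementary_test_function[OF trial_elementary, of R]) (simp add: trial_def \<psi>)

lemma psi_sq: "0 \<le> (\<psi> x)\<^sup>2" "(\<psi> x)\<^sup>2 \<le> 1"
  using \<psi>(3,4)[of x] power_le_one by auto

lemma freq_k_nonneg: "0 \<le> freq * real k"
  using freq_pos by simp

lemma abs_trial_le: "\<bar>trial a x\<bar> \<le> (\<Sum>j\<le>k. \<bar>a j\<bar>)"
  using mult_mono[OF abs_cos_poly_le[of freq k a "G x"], of "\<bar>\<psi> x\<bar>" 1] \<psi>(3,4)[of x]
  by (simp add: trial_def abs_mult sum_nonneg)

text \<open>The cutoff costs at most \<open>A^2 * (1 - (\<psi> x)^2)\<close>, and passing from
  \<open>cumul\<close> to \<open>G\<close> costs a Lipschitz error, through the factorisation of a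
  difference of squares. Where \<open>\<bar>x\<bar> > R\<close> nothing is known about
  \<open>G\<close>, but there \<open>\<psi> x = 0\<close> and the first loss alone suffices.\<close>

lemma trial_squared_ge:
  fixes a defines "A \<equiv> (\<Sum>j\<le>k. \<bar>a j\<bar>)"
  shows "(cos_poly freq k a (cumul x))\<^sup>2 - A\<^sup>2 * (1 - (\<psi> x)\<^sup>2) - 2 * (freq * real k) * e * A\<^sup>2
    \<le> (trial a x)\<^sup>2"
proof -
  define p where "p = cos_poly freq k a (cumul x)"
  define v where "v = cos_poly freq k a (G x)"
  define c where "c = 2 * (freq * real k) * e * A\<^sup>2"
  have A: "0 \<le> A" by (simp add: A_def sum_nonneg)
  have c: "0 \<le> c" using freq_pos e unfolding c_def by (intro mult_nonneg_nonneg) auto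
  have pA: "\<bar>p\<bar> \<le> A" "\<bar>v\<bar> \<le> A" unfolding p_def v_def A_def by (rule abs_cos_poly_le)+
  then have p2: "p\<^sup>2 \<le> A\<^sup>2" by (simp add: abs_le_square_iff[symmetric])
  show ?thesis
  proof (cases "\<bar>x\<bar> \<le> R")
    case True
    have "\<bar>p - v\<bar> \<le> freq * real k * \<bar>cumul x - G x\<bar> * A"
      unfolding p_def v_def A_def using freq_pos by (intro cos_poly_lipschitz) auto
    also have "\<dots> \<le> freq * real k * e * A"
      using G(2)[OF True] A freq_k_nonneg
      by (intro mult_right_mono mult_left_mono) (auto simp: abs_minus_commute)
    finally have "\<bar>p - v\<bar> * \<bar>p + v\<bar> \<le> (freq * real k * e * A) * (2 * A)"
      using pA by (intro mult_mono) auto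
    moreover have "p\<^sup>2 - v\<^sup>2 \<le> \<bar>p - v\<bar> * \<bar>p + v\<bar>"
      by (metis abs_ge_self abs_mult mult.commute square_diff_square_factored power2_eq_square)
    ultimately have pv: "p\<^sup>2 - v\<^sup>2 \<le> c" by (simp add: c_def power2_eq_square algebra_simps)
    have "(p\<^sup>2 - v\<^sup>2) * (\<psi> x)\<^sup>2 \<le> c * (\<psi> x)\<^sup>2"
      using pv psi_sq by (intro mult_right_mono)
    also have "\<dots> \<le> c * 1" using c psi_sq by (intro mult_left_mono)
    finally have "(p\<^sup>2 - v\<^sup>2) * (\<psi> x)\<^sup>2 \<le> c" by simp
    moreover have "p\<^sup>2 * (1 - (\<psi> x)\<^sup>2) \<le> A\<^sup>2 * (1 - (\<psi> x)\<^sup>2)"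
      using p2 psi_sq[of x] by (intro mult_right_mono) auto
    ultimately show ?thesis
      unfolding trial_def p_def[symmetric] v_def[symmetric] c_def[symmetric]
      by (simp add: power_mult_distrib algebra_simps)
  next
    case False
    then have "\<psi> x = 0" using \<psi>(2) by simp
    then show ?thesis using p2 c
      by (simp add: trial_def p_def[symmetric] c_def[symmetric])
  qed
qed

lemma deriv_trial:
  "deriv (trial a) x = - sin_poly freq k a (G x) * deriv G x * \<psi> x + cos_poly freq k a (G x) * deriv \<psi> x"
proof -
  have "((\<lambda>x. cos_poly freq k a (G x)) has_real_derivative - sin_poly freq k a (G x) * deriv G x) (at x)"
    by (rule DERIV_chain2[OF cos_poly_has_derivative elementary_DERIV[OF G(1)]])
  from DERIV_mult[OF this elementary_DERIV[OF \<psi>(1)]] show ?thesis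
    unfolding trial_def by (intro DERIV_imp_deriv) (simp add: algebra_simps)
qed

text \<open>The three summands of \<open>K\<close> stem from moving the argument of the sine sum
  from \<open>cumul x\<close> to \<open>G x\<close>, from the slope \<open>1 + e\<close> of
  \<open>G\<close>, and from the slope of \<open>\<psi>\<close>.\<close>

lemma deriv_trial_squared_le:
  fixes a defines "A \<equiv> (\<Sum>j\<le>k. \<bar>a j\<bar>)" and "K \<equiv> (freq * real k)\<^sup>2 + freq * real k + 1"
  shows "(deriv (trial a) x)\<^sup>2
    \<le> (sin_poly freq k a (cumul x))\<^sup>2 + e * ((2 * (freq * real k) * K + K\<^sup>2) * A\<^sup>2)"
proof -
  define s where "s = sin_poly freq k a (cumul x)"
  define v where "v = sin_poly freq k a (G x)"
  define W where "W = freq * real k"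
  have W: "0 \<le> W" using freq_k_nonneg by (simp add: W_def)
  have A: "0 \<le> A" by (simp add: A_def sum_nonneg)
  have K: "0 \<le> K" using W by (simp add: K_def W_def)
  have sA: "\<bar>s\<bar> \<le> W * A" and vA: "\<bar>v\<bar> \<le> W * A"
    using abs_sin_poly_le[OF less_imp_le[OF freq_pos]] by (auto simp: s_def v_def W_def A_def)
  have p: "\<bar>cos_poly freq k a (G x) * deriv \<psi> x\<bar> \<le> A * e"
    unfolding abs_mult A_def using \<psi>(5) by (intro mult_mono abs_cos_poly_le) (auto simp: sum_nonneg)
  have "\<bar>deriv (trial a) x\<bar> \<le> \<bar>s\<bar> + e * K * A"
  proof (cases "\<bar>x\<bar> \<le> R")
    case True
    have "\<bar>v - s\<bar> \<le> W\<^sup>2 * \<bar>G x - cumul x\<bar> * A"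
      unfolding s_def v_def A_def W_def using freq_pos by (intro sin_poly_lipschitz) auto
    also have "\<dots> \<le> W\<^sup>2 * e * A"
      using G(2)[OF True] A by (intro mult_right_mono mult_left_mono) auto
    finally have vs: "\<bar>v\<bar> \<le> \<bar>s\<bar> + W\<^sup>2 * e * A" by linarith
    have "\<bar>v * deriv G x * \<psi> x\<bar> \<le> \<bar>v\<bar> * (1 + e) * 1"
      unfolding abs_mult using G(3)[OF True] \<psi>(3,4)[of x] e by (intro mult_mono) auto
    also have "\<dots> = \<bar>v\<bar> + e * \<bar>v\<bar>" by (simp add: algebra_simps)
    also have "\<dots> \<le> \<bar>s\<bar> + W\<^sup>2 * e * A + e * (W * A)"
      using vs vA e by (intro add_mono mult_left_mono) auto
    finally have "\<bar>v * deriv G x * \<psi> x\<bar> \<le> \<bar>s\<bar> + W\<^sup>2 * e * A + e * (W * A)" .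
    moreover have "\<bar>deriv (trial a) x\<bar> \<le> \<bar>v * deriv G x * \<psi> x\<bar> + \<bar>cos_poly freq k a (G x) * deriv \<psi> x\<bar>"
      unfolding deriv_trial v_def[symmetric] using abs_triangle_ineq[of "- v * deriv G x * \<psi> x"] by simp
    moreover have "\<bar>s\<bar> + W\<^sup>2 * e * A + e * (W * A) + A * e = \<bar>s\<bar> + e * K * A"
      by (simp add: K_def W_def algebra_simps)
    ultimately show ?thesis using p by linarith
  next
    case False
    \<comment> \<open>Here \<open>deriv G\<close> is not controlled, but its term carries the factor
      \<open>\<psi> x = 0\<close>.\<close>
    then have "\<bar>deriv (trial a) x\<bar> \<le> A * e" using \<psi>(2)[of x] p by (simp add: deriv_trial)
    also have "\<dots> \<le> e * K * A"
      using e A W mult_left_mono[of 1 K "e * A"] by (simp add: K_def W_def mult.commute mult.left_commute)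
    finally show ?thesis by simp
  qed
  then have "(deriv (trial a) x)\<^sup>2 \<le> (\<bar>s\<bar> + e * K * A)\<^sup>2"
    by (metis abs_ge_zero power2_abs power_mono)
  also have "\<dots> = s\<^sup>2 + e * (2 * K * A * \<bar>s\<bar>) + e * (e * (K * A)\<^sup>2)"
    by (simp add: power2_sum power_mult_distrib power2_eq_square[of e] algebra_simps)
  \<comment> \<open>The cross term uses \<open>\<bar>s\<bar> \<le> W * A\<close>, the quadratic term
    \<open>e \<le> 1\<close>, so that the total error is linear in \<open>e\<close>.\<close>
  also have "\<dots> \<le> s\<^sup>2 + e * (2 * K * A * (W * A)) + e * (1 * (K * A)\<^sup>2)"
    using e K A sA by (intro add_mono mult_left_mono mult_right_mono) auto
  also have "\<dots> = s\<^sup>2 + e * ((2 * W * K + K\<^sup>2) * A\<^sup>2)"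
    by (simp add: power_mult_distrib power2_eq_square algebra_simps)
  finally show ?thesis by (simp add: s_def W_def)
qed

lemma trial_squared_le: "(trial a x)\<^sup>2 \<le> (\<Sum>j\<le>k. \<bar>a j\<bar>)\<^sup>2"
  using abs_trial_le[of a x] by (metis abs_ge_zero power2_abs power_mono)

lemma integrable_poly_squared:
  "integrable lebesgue (\<lambda>x. \<rho> x * (cos_poly freq k a (cumul x))\<^sup>2)"
  "integrable lebesgue (\<lambda>x. \<rho> x * (sin_poly freq k a (cumul x))\<^sup>2)"
proof -
  have "(cos_poly freq k a t)\<^sup>2 \<le> (\<Sum>j\<le>k. \<bar>a j\<bar>)\<^sup>2" for t
    using abs_cos_poly_le[of freq k a t] by (metis abs_ge_zero power2_abs power_mono)
  then show "integrable lebesgue (\<lambda>x. \<rho> x * (cos_poly freq k a (cumul x))\<^sup>2)"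
    unfolding cos_poly_def
    by (intro integrable_weighted[where C = "(\<Sum>j\<le>k. \<bar>a j\<bar>)\<^sup>2"] continuous_imp_measurable_lebesgue
        continuous_intros cumul_continuous) simp
  have "(sin_poly freq k a t)\<^sup>2 \<le> (freq * real k * (\<Sum>j\<le>k. \<bar>a j\<bar>))\<^sup>2" for t
    using abs_sin_poly_le[OF less_imp_le[OF freq_pos], of k a t] by (metis abs_ge_zero power2_abs power_mono)
  then show "integrable lebesgue (\<lambda>x. \<rho> x * (sin_poly freq k a (cumul x))\<^sup>2)"
    unfolding sin_poly_def
    by (intro integrable_weighted[where C = "(freq * real k * (\<Sum>j\<le>k. \<bar>a j\<bar>))\<^sup>2"]
        continuous_imp_measurable_lebesgue continuous_intros cumul_continuous) simp
qed

text \<open>Integrating the pointwise bound leaves a loss proportional to \<open>A^2\<close>, which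
  \<open>l1_squared_le_norm2\<close> makes a fraction of \<open>norm2 k a\<close>.\<close>

lemma integral_trial_ge:
  "norm2 k a * (1 - e * defect k) \<le> (\<integral>x. \<rho> x * (trial a x)\<^sup>2 \<partial>lebesgue)"
proof -
  define A where "A = (\<Sum>j\<le>k. \<bar>a j\<bar>)"
  define p where "p = cos_poly freq k a"
  define c where "c = 2 * (freq * real k) * e * A\<^sup>2"
  have int_psi: "integrable lebesgue (\<lambda>x. \<rho> x * (1 - (\<psi> x)\<^sup>2))"
    by (rule integrable_weighted_elementary[of _ 1])
      (use psi_sq in \<open>auto intro!: elementary_intros \<psi>(1)\<close>)
  note int_p = integrable_poly_squared(1)[of a, folded p_def]
  have int_t: "integrable lebesgue (\<lambda>x. \<rho> x * (trial a x)\<^sup>2)"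
    by (rule integrable_weighted_elementary[of _ "(\<Sum>j\<le>k. \<bar>a j\<bar>)\<^sup>2"])
      (use trial_squared_le in \<open>auto intro!: elementary_intros trial_elementary\<close>)
  have "norm2 k a - A\<^sup>2 * (\<integral>x. \<rho> x * (1 - (\<psi> x)\<^sup>2) \<partial>lebesgue) - c * mass
    = (\<integral>x. \<rho> x * (p (cumul x))\<^sup>2 - A\<^sup>2 * (\<rho> x * (1 - (\<psi> x)\<^sup>2)) - c * \<rho> x \<partial>lebesgue)"
    using int_p int_psi integrable by (simp add: integral_cos_poly p_def mass_def)
  also have "\<dots> \<le> (\<integral>x. \<rho> x * (trial a x)\<^sup>2 \<partial>lebesgue)"
  proof (rule integral_mono)
    show "\<rho> x * (p (cumul x))\<^sup>2 - A\<^sup>2 * (\<rho> x * (1 - (\<psi> x)\<^sup>2)) - c * \<rho> x \<le> \<rho> x * (trial a x)\<^sup>2" for x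
    proof -
      have "(p (cumul x))\<^sup>2 - A\<^sup>2 * (1 - (\<psi> x)\<^sup>2) - c \<le> (trial a x)\<^sup>2"
        using trial_squared_ge[of a x] by (simp add: A_def p_def c_def)
      from mult_left_mono[OF this nonneg[of x]] show ?thesis by (simp add: algebra_simps)
    qed
  qed (use int_p int_psi integrable int_t in auto)
  finally have lower: "norm2 k a - A\<^sup>2 * (\<integral>x. \<rho> x * (1 - (\<psi> x)\<^sup>2) \<partial>lebesgue) - c * mass
    \<le> (\<integral>x. \<rho> x * (trial a x)\<^sup>2 \<partial>lebesgue)" .
  have "A\<^sup>2 * (\<integral>x. \<rho> x * (1 - (\<psi> x)\<^sup>2) \<partial>lebesgue) + c * mass \<le> A\<^sup>2 * e + c * mass"
    using \<psi>(6) by (intro add_right_mono mult_left_mono) auto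
  also have "\<dots> = A\<^sup>2 * (e * (1 + 2 * (freq * real k) * mass))"
    by (simp add: c_def algebra_simps)
  also have "\<dots> \<le> (2 * (real k + 1) / mass * norm2 k a) * (e * (1 + 2 * (freq * real k) * mass))"
    using l1_squared_le_norm2[of a k] e freq_k_nonneg mass_pos
    by (intro mult_right_mono) (auto simp: A_def)
  also have "\<dots> = norm2 k a * (e * defect k)" by (simp add: defect_def ac_simps)
  finally show ?thesis using lower by (simp add: algebra_simps)
qed

lemma integral_deriv_trial_le:
  "(\<integral>x. \<rho> x * (deriv (trial a) x)\<^sup>2 \<partial>lebesgue) \<le> norm2 k a * ((freq * real k)\<^sup>2 + e * excess k)"
proof -
  define A where "A = (\<Sum>j\<le>k. \<bar>a j\<bar>)"
  define s where "s = sin_poly freq k a"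
  define K where "K = (freq * real k)\<^sup>2 + freq * real k + 1"
  define c where "c = e * ((2 * (freq * real k) * K + K\<^sup>2) * A\<^sup>2)"
  note int_s = integrable_poly_squared(2)[of a, folded s_def]
  have bound: "(deriv (trial a) x)\<^sup>2 \<le> (s (cumul x))\<^sup>2 + c" for x
    using deriv_trial_squared_le[of a x] by (simp add: A_def s_def K_def c_def)
  have K: "0 \<le> K" using freq_k_nonneg by (simp add: K_def)
  have "(s (cumul x))\<^sup>2 \<le> (freq * real k * A)\<^sup>2" for x
    using abs_sin_poly_le[OF less_imp_le[OF freq_pos], of k a "cumul x"]
    unfolding s_def A_def by (metis abs_ge_zero power2_abs power_mono)
  then have "(deriv (trial a) x)\<^sup>2 \<le> (freq * real k * A)\<^sup>2 + c" for x
    using bound[of x] by (meson add_right_mono order_trans)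
  then have int_t: "integrable lebesgue (\<lambda>x. \<rho> x * (deriv (trial a) x)\<^sup>2)"
    by (intro integrable_weighted_elementary[of _ "(freq * real k * A)\<^sup>2 + c"]
        elementary_intros elementary_deriv trial_elementary) simp
  have "(\<integral>x. \<rho> x * (deriv (trial a) x)\<^sup>2 \<partial>lebesgue) \<le> (\<integral>x. \<rho> x * (s (cumul x))\<^sup>2 + c * \<rho> x \<partial>lebesgue)"
  proof (rule integral_mono)
    show "\<rho> x * (deriv (trial a) x)\<^sup>2 \<le> \<rho> x * (s (cumul x))\<^sup>2 + c * \<rho> x" for x
      using mult_left_mono[OF bound nonneg] by (simp add: algebra_simps)
  qed (use int_s integrable int_t in auto)
  also have "\<dots> = (\<integral>x. \<rho> x * (s (cumul x))\<^sup>2 \<partial>lebesgue) + c * mass"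
    using int_s integrable by (simp add: mass_def)
  also have "\<dots> \<le> (freq * real k)\<^sup>2 * norm2 k a + c * mass"
    using integral_sin_poly_le by (simp add: s_def)
  also have "c * mass = A\<^sup>2 * (e * ((2 * (freq * real k) * K + K\<^sup>2) * mass))"
    by (simp add: c_def algebra_simps)
  also have "\<dots> \<le> (2 * (real k + 1) / mass * norm2 k a) * (e * ((2 * (freq * real k) * K + K\<^sup>2) * mass))"
    using l1_squared_le_norm2[of a k] e freq_pos mass_pos K
    by (intro mult_right_mono) (auto simp: A_def)
  also have "\<dots> = norm2 k a * (e * excess k)"
    unfolding excess_def Let_def K_def[symmetric] by (simp add: ac_simps)
  finally show ?thesis by (simp add: algebra_simps)
qed

text \<open>Numerator and denominator bounds share the factor \<open>norm2 k a\<close>; it cancels,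
  leaving a bound independent of the coefficients.\<close>

lemma rayleigh_trial_le:
  assumes "e * defect k < 1" "norm2 k a > 0"
  shows "rayleigh \<rho> (trial a) \<le> ((freq * real k)\<^sup>2 + e * excess k) / (1 - e * defect k)"
proof -
  have pos: "0 < norm2 k a * (1 - e * defect k)" using assms by simp
  have "rayleigh \<rho> (trial a) \<le> norm2 k a * ((freq * real k)\<^sup>2 + e * excess k) / (norm2 k a * (1 - e * defect k))"
    unfolding rayleigh_def
  proof (rule frac_le)
    have "0 \<le> (\<integral>x. \<rho> x * (deriv (trial a) x)\<^sup>2 \<partial>lebesgue)"
      by (intro Bochner_Integration.integral_nonneg) (simp add: nonneg)
    also note integral_deriv_trial_le
    finally show "0 \<le> norm2 k a * ((freq * real k)\<^sup>2 + e * excess k)" .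
  qed (use pos integral_trial_ge integral_deriv_trial_le in auto)
  then show ?thesis using assms(2) by simp
qed

section \<open>The span of the trial functions and its dimension\<close>

text \<open>A linear map on coefficient sequences; only the entries up to \<open>k\<close>
  matter.\<close>

definition trial_class :: "(nat \<Rightarrow> real) \<Rightarrow> ae_fun" where
  "trial_class a = restricted_class \<rho> (trial a)"

lemma trial_class_add: "trial_class (\<lambda>j. a j + b j) = trial_class a + trial_class b"
  by (simp add: trial_class_def restricted_class_add[symmetric] trial_def cos_poly_def
      sum.distrib distrib_right)

lemma trial_class_scaleR: "trial_class (\<lambda>j. c * a j) = c *\<^sub>R trial_class a"
proof -
  have "trial (\<lambda>j. c * a j) = (\<lambda>x. c * trial a x)"
    by (simp add: trial_def cos_poly_def sum_distrib_left sum_distrib_right mult.assoc)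
  then show ?thesis by (simp add: trial_class_def restricted_class_scaleR)
qed

lemma trial_class_zero: "trial_class (\<lambda>j. 0) = 0"
  by (simp add: trial_class_def restricted_class_zero[symmetric, of \<rho>] trial_def cos_poly_def)

lemma trial_class_cong: "(\<And>j. j \<le> k \<Longrightarrow> a j = b j) \<Longrightarrow> trial_class a = trial_class b"
  by (simp add: trial_class_def trial_def cos_poly_def)

lemma trial_class_sum: "finite A \<Longrightarrow> trial_class (\<lambda>j. \<Sum>i\<in>A. f i j) = (\<Sum>i\<in>A. trial_class (f i))"
  by (induction A rule: finite_induct) (auto simp: trial_class_zero trial_class_add)

lemma trial_class_expansion: "trial_class a = (\<Sum>i\<le>k. a i *\<^sub>R trial_class (unit_coeff i))"
proof -
  have "trial_class a = trial_class (\<lambda>j. \<Sum>i\<le>k. a i * unit_coeff i j)"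
    by (rule trial_class_cong) (simp add: unit_coeff_def if_distrib cong: if_cong)
  then show ?thesis by (simp add: trial_class_sum trial_class_scaleR)
qed

text \<open>A vanishing class has weighted norm 0, whereas \<open>integral_trial_ge\<close> makes
  that norm positive as soon as some coefficient up to \<open>k\<close> is nonzero.\<close>

lemma trial_class_eq_0D:
  assumes "e * defect k < 1" "trial_class a = 0" "j \<le> k"
  shows "a j = 0"
proof (rule ccontr)
  assume "a j \<noteq> 0"
  then have "0 < norm2 k a * (1 - e * defect k)" using assms norm2_pos by simp
  also note integral_trial_ge
  also have "(\<integral>x. \<rho> x * (trial a x)\<^sup>2 \<partial>lebesgue) = 0"
  proof (rule integral_eq_zero_AE)
    have "AE x in lebesgue. \<rho> x > 0 \<longrightarrow> trial a x = 0"
      using assms(2) by (simp add: trial_class_def restricted_class_zero[symmetric, of \<rho>] restricted_class_eq_iff)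
    then show "AE x in lebesgue. \<rho> x * (trial a x)\<^sup>2 = 0"
    proof eventually_elim
      case (elim x)
      then show ?case using nonneg[of x] by (cases "\<rho> x = 0") auto
    qed
  qed
  finally show False by simp
qed

lemma range_trial_class_in_test_subspaces:
  assumes "e * defect k < 1"
  shows "range trial_class \<in> test_subspaces \<rho> k"
proof -
  let ?b = "\<lambda>i. trial_class (unit_coeff i)"
  let ?B = "?b ` {..k}"
  have sub: "subspace (range trial_class)"
    unfolding subspace_def
    using trial_class_zero trial_class_add[symmetric] trial_class_scaleR[symmetric] by (auto intro: range_eqI)
  \<comment> \<open>Independence concerns the set \<open>?B\<close>; distinctness of the images is
    what makes its cardinality \<open>k + 1\<close>.\<close>
  have inj: "inj_on ?b {..k}"
  proof (rule inj_onI)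
    fix i j assume ij: "i \<in> {..k}" "j \<in> {..k}" "?b i = ?b j"
    have "trial_class (\<lambda>l. unit_coeff i l + (- 1) * unit_coeff j l) = 0"
      unfolding trial_class_add trial_class_scaleR using ij(3) by simp
    from trial_class_eq_0D[OF assms this, of i] ij show "i = j"
      by (auto simp: unit_coeff_def split: if_splits)
  qed
  have indep: "independent ?B"
  proof (rule independent_if_scalars_zero)
    fix f x assume "(\<Sum>x\<in>?B. f x *\<^sub>R x) = 0" and x: "x \<in> ?B"
    then have "trial_class (\<lambda>i. f (?b i)) = 0"
      using inj by (simp add: sum.reindex trial_class_expansion[of "\<lambda>i. f (?b i)"])
    with x show "f x = 0" using trial_class_eq_0D[OF assms] by fastforce
  qed simp
  have "range trial_class = span ?B"
  proof
    show "range trial_class \<subseteq> span ?B"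
    proof
      fix v assume "v \<in> range trial_class"
      then obtain a where "v = trial_class a" by auto
      moreover have "(\<Sum>i\<le>k. a i *\<^sub>R ?b i) \<in> span ?B"
        by (intro span_sum span_scale span_base imageI)
      ultimately show "v \<in> span ?B" using trial_class_expansion[of a] by simp
    qed
    show "span ?B \<subseteq> range trial_class" by (rule span_minimal) (auto simp: sub)
  qed
  then have "dim (range trial_class) = k + 1"
    using indep inj by (simp add: dim_eq_card_independent card_image)
  moreover have "range trial_class \<subseteq> restricted_class \<rho> ` test_functions"
    using trial_test_function by (auto simp: trial_class_def)
  ultimately show ?thesis using sub by (simp add: test_subspaces_def)
qed

section \<open>The bound with error and its limit\<close>

lemma mu_le_perturbed:
  assumes "e * defect k < 1"
  shows "mu \<rho> k \<le> ereal (((freq * real k)\<^sup>2 + e * excess k) / (1 - e * defect k))"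
  unfolding mu_def
proof (rule INF_lower2[OF range_trial_class_in_test_subspaces[OF assms]], rule SUP_least)
  fix u assume "u \<in> {u \<in> test_functions. restricted_class \<rho> u \<in> range trial_class - {0}}"
  then obtain a where u: "u \<in> test_functions" "restricted_class \<rho> u = trial_class a" "trial_class a \<noteq> 0"
    by auto
  have "\<exists>j\<le>k. a j \<noteq> 0"
    using u(3) trial_class_cong[of a "\<lambda>_. 0"] trial_class_zero by auto
  then have "norm2 k a > 0" using norm2_pos by blast
  \<comment> \<open>The supremum runs over all smooth representatives, so the quotient is
    transferred from \<open>u\<close> to the trial function of the same class.\<close>
  moreover have "rayleigh \<rho> u = rayleigh \<rho> (trial a)"
    using u by (intro rayleigh_cong trial_test_function) (simp add: trial_class_def)+
  ultimately show "ereal (rayleigh \<rho> u) \<le> ereal (((freq * real k)\<^sup>2 + e * excess k) / (1 - e * defect k))"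
    using rayleigh_trial_le[OF assms] by simp
qed

end

text \<open>The perturbed bounds tend to \<open>(freq * real k)^2\<close> as \<open>e\<close>
  decreases to 0, since \<open>defect k\<close> and \<open>excess k\<close> do not depend on
  \<open>e\<close>.\<close>

lemma mu_le: "mu \<rho> k \<le> ereal ((freq * real k)\<^sup>2)"
proof (rule ereal_le_epsilon2)
  fix d :: real assume "0 < d"
  define q where "q e = ((freq * real k)\<^sup>2 + e * excess k) / (1 - e * defect k)" for e
  have "(q \<longlongrightarrow> ((freq * real k)\<^sup>2 + 0 * excess k) / (1 - 0 * defect k)) (at_right 0)"
    unfolding q_def by (intro tendsto_intros) auto
  then have "\<forall>\<^sub>F e in at_right 0. q e < (freq * real k)\<^sup>2 + d"
    by (rule order_tendstoD) (use \<open>0 < d\<close> in simp)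
  moreover have "((\<lambda>e. e * defect k) \<longlongrightarrow> 0 * defect k) (at_right 0)"
    by (intro tendsto_intros)
  then have "\<forall>\<^sub>F e in at_right 0. e * defect k < 1"
    by (rule order_tendstoD) simp
  moreover have "\<forall>\<^sub>F e in at_right 0. e \<in> {0<..<1::real}"
    by (rule eventually_at_right_field[THEN iffD2]) (auto intro!: exI[of _ 1])
  ultimately have "\<forall>\<^sub>F e in at_right 0. q e < (freq * real k)\<^sup>2 + d \<and> e * defect k < 1 \<and> e \<in> {0<..<1}"
    by eventually_elim auto
  then obtain e where e: "q e < (freq * real k)\<^sup>2 + d" "e * defect k < 1" "0 < e" "e < 1"
    using eventually_happens'[OF trivial_limit_at_right_real] by fastforce
  \<comment> \<open>The cutoff comes first, because it fixes the radius \<open>R\<close> within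
    which \<open>G\<close> has to approximate \<open>cumul\<close>.\<close>
  obtain \<psi> R where \<psi>: "\<psi> \<in> elementary" "\<And>x. R \<le> \<bar>x\<bar> \<Longrightarrow> \<psi> x = 0" "\<And>x. 0 \<le> \<psi> x" "\<And>x. \<psi> x \<le> 1"
    "\<And>x. \<bar>deriv \<psi> x\<bar> \<le> e" "(\<integral>x. \<rho> x * (1 - (\<psi> x)\<^sup>2) \<partial>lebesgue) \<le> e"
    using cutoff_exists[OF e(3)] by blast
  obtain G where G: "G \<in> elementary" "\<And>x. \<bar>x\<bar> \<le> R \<Longrightarrow> \<bar>G x - cumul x\<bar> \<le> e"
    "\<And>x. \<bar>x\<bar> \<le> R \<Longrightarrow> \<bar>deriv G x\<bar> \<le> 1 + e"
    using lipschitz_approx_elementary[OF cumul_lipschitz e(3)] by blast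
  have "mu \<rho> k \<le> ereal (q e)"
    unfolding q_def by (rule mu_le_perturbed[OF e(3) less_imp_le[OF e(4)] G \<psi> e(2)])
  also have "\<dots> \<le> ereal ((freq * real k)\<^sup>2 + d)" using e(1) by simp
  finally show "mu \<rho> k \<le> ereal ((freq * real k)\<^sup>2) + ereal d" by simp
qed

end

theorem corollary17:
  fixes \<rho> :: "real \<Rightarrow> real"
  assumes "integrable lebesgue \<rho>"
    and "\<And>x. 0 \<le> \<rho> x \<and> \<rho> x \<le> 1"
    and "\<not> (AE x in lebesgue. \<rho> x = 0)"
  shows "\<forall>k::nat. mu \<rho> k \<le> ereal (pi\<^sup>2 * (real k)\<^sup>2 / (\<integral>x. \<rho> x \<partial>lebesgue)\<^sup>2)"
proof
  fix k
  interpret mass_density \<rho> by unfold_locales (use assms in auto)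
  show "mu \<rho> k \<le> ereal (pi\<^sup>2 * (real k)\<^sup>2 / (\<integral>x. \<rho> x \<partial>lebesgue)\<^sup>2)"
    using mu_le[of k] by (simp add: freq_def mass_def power_mult_distrib power_divide)
qed

end
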